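(* Let $\mathbb{X}$ and $\Xi^\Gamma$ be the hull and the internal system generated by a cut and project scheme $(\mathsf{H},\Sigma,\mathbb{R}^d)$ and some window $W$. Then there is a homeomorphism and semigroup isomorphism $$E(\Xi^\Gamma,\Gamma)\times_\Gamma\mathbb{R}^d\;\simeq\;E(\mathbb{X},\mathbb{R}^d)$$ mapping each element $[g,t]_\Gamma$ of $E(\Xi^\Gamma,\Gamma)\times_\Gamma\mathbb{R}^d$ to $\widetilde{g}-t$.
   Context: **Cut and project scheme.** $(\mathsf{H},\Sigma,\mathbb{R}^d)$: $\mathsf{H}$ is a locally compact Abelian group, $\Sigma$ is a countable discrete cocompact subgroup of $\mathsf{H}\times\mathbb{R}^d$, the projection to $\mathbb{R}^d$ is injective on $\Sigma$ with image $\Gamma$, and the projection of $\Sigma$ to $\mathsf{H}$ is a dense subgroup $\Gamma^*$. For $\gamma\in\Gamma$, $\gamma^*\in\mathsf{H}$ is the unique element with $(\gamma^*,\gamma)\in\Sigma$. A window is a compact topologically regular (equal to the closure of its interior) subset $W\subset\mathsf{H}$ which is irredundant: $W+w=W$ only for $w=0$. For $A\subset\mathsf{H}$, $\mathfrak{P}(A)=\{\gamma\in\Gamma:\gamma^*\in A\}$. **Hull.** $NS=(\Gamma^*-\partial W)^c\subset\mathsf{H}$. For $w\in NS$, $t\in\mathbb{R}^d$, the sets $\mathfrak{P}(w+W)-t=\mathfrak{P}(w+\mathring{W})-t$ are the nonsingular model sets; they all have the same language $\mathcal{L}_{NS}$, where $\mathcal{L}_\Lambda=\{(\Lambda-x)\cap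 B(0,R):x\in\Lambda,R>0\}$ for $\Lambda\subset\mathbb{R}^d$. The hull is $\mathbb{X}=\{\Lambda\subset\mathbb{R}^d:\mathcal{L}_\Lambda=\mathcal{L}_{NS}\}$, with neighborhood bases $\{\Lambda'\in\mathbb{X}:\exists |t|,|t'|<\varepsilon,\ (\Lambda-t)\cap K=(\Lambda'-t')\cap K\}$, $K\subset\mathbb{R}^d$ compact, $\varepsilon>0$; it is compact metrizable, and $\mathbb{R}^d$ acts by $\Lambda.t=\Lambda-t$. **Internal system.** $\Xi^\Gamma=\{\Lambda\in\mathbb{X}:\Lambda\subset\Gamma\}$ with neighborhood bases $\{\Lambda'\in\Xi^\Gamma:\Lambda\cap K=\Lambda'\cap K\}$, $K\subset\mathbb{R}^d$ compact (a locally compact space); $\Gamma$ acts by homeomorphisms by $\Lambda.\gamma=\Lambda+\gamma$. **Ellis semigroups.** For a group $T$ acting by homeomorphisms on a (locally) compact space $X$, $E(X,T)$ is the closure of (the image of) $T$ in $X^X$ for pointwise convergence, with that topology and the product $x.(g.h)=(x.g).h$. **Suspension.** $E(\Xi^\Gamma,\Gamma)\times_\Gamma\mathbb{R}^d$ is the topological quotient semigroup of the direct product semigroup $E(\Xi^\Gamma,\Gamma)\times\mathbb{R}^d$ by the subsemigroup of elements $(\gamma,\gamma)$, $\gamma\in\Gamma$ (i.e. $(g,t)\sim(g.\gamma,t+\gamma)$); classes are written $[g,t]_\Gamma$. Every element of $\mathbb{X}$ has the form $\Lambda-t$ with $\Lambda\in\Xi^\Gamma$, $t\in\mathbb{R}^d$;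 for $g\in E(\Xi^\Gamma,\Gamma)$ the map $\widetilde g:\mathbb{X}\to\mathbb{X}$, $(\Lambda-t).\widetilde g:=\Lambda.g-t$, is well defined, and $\widetilde g-t$ denotes the map $\Lambda_0\mapsto\Lambda_0.\widetilde g-t$ on $\mathbb{X}$. *)

theory Defs
  imports "HOL-Analysis.Analysis" "HOL-Algebra.Coset"
begin

section \<open>Topologies from neighbourhood bases and from quotients\<close>

text \<open>The topology on \<open>X\<close> in which the sets in \<open>N x\<close> form a neighbourhood base of \<open>x\<close>.\<close>

definition nbhd_base_topology :: "'a set \<Rightarrow> ('a \<Rightarrow> 'a set set) \<Rightarrow> 'a topology" where
  "nbhd_base_topology X N = topology (\<lambda>U. U \<subseteq> X \<and> (\<forall>x\<in>U. \<exists>V\<in>N x. V \<subseteq> U))"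

lemma openin_nbhd_base_topology:
  assumes "\<And>x V V'. x \<in> X \<Longrightarrow> V \<in> N x \<Longrightarrow> V' \<in> N x \<Longrightarrow> \<exists>V''\<in>N x. V'' \<subseteq> V \<inter> V'"
  shows "openin (nbhd_base_topology X N) U \<longleftrightarrow> U \<subseteq> X \<and> (\<forall>x\<in>U. \<exists>V\<in>N x. V \<subseteq> U)"
proof -
  have "istopology (\<lambda>U. U \<subseteq> X \<and> (\<forall>x\<in>U. \<exists>V\<in>N x. V \<subseteq> U))"
    unfolding istopology_def
  proof (intro conjI allI impI)
    fix S T assume S: "S \<subseteq> X \<and> (\<forall>x\<in>S. \<exists>V\<in>N x. V \<subseteq> S)"
      and T: "T \<subseteq> X \<and> (\<forall>x\<in>T. \<exists>V\<in>N x. V \<subseteq> T)"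
    show "S \<inter> T \<subseteq> X" using S by blast
    show "\<forall>x\<in>S \<inter> T. \<exists>V\<in>N x. V \<subseteq> S \<inter> T"
    proof
      fix x assume x: "x \<in> S \<inter> T"
      obtain V where V: "V \<in> N x" "V \<subseteq> S" using x S by blast
      obtain V' where V': "V' \<in> N x" "V' \<subseteq> T" using x T by blast
      have "x \<in> X" using x S by blast
      from assms[OF this V(1) V'(1)] obtain V'' where "V'' \<in> N x" "V'' \<subseteq> V \<inter> V'" ..
      with V(2) V'(2) show "\<exists>V\<in>N x. V \<subseteq> S \<inter> T" by (intro bexI[of _ V'']) auto
    qed
  next
    fix K assume K: "\<forall>S\<in>K. S \<subseteq> X \<and> (\<forall>x\<in>S. \<exists>V\<in>N x. V \<subseteq> S)"
    show "\<Union>K \<subseteq> X" using K by blast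
    show "\<forall>x\<in>\<Union>K. \<exists>V\<in>N x. V \<subseteq> \<Union>K"
    proof
      fix x assume "x \<in> \<Union>K"
      then obtain S where S: "S \<in> K" "x \<in> S" by blast
      with K obtain V where "V \<in> N x" "V \<subseteq> S" by blast
      with S(1) show "\<exists>V\<in>N x. V \<subseteq> \<Union>K" by (intro bexI[of _ V]) auto
    qed
  qed
  then show ?thesis by (simp add: nbhd_base_topology_def)
qed

definition quotient_topology :: "'a topology \<Rightarrow> ('a \<Rightarrow> 'b) \<Rightarrow> 'b topology" where
  "quotient_topology X q =
     topology (\<lambda>U. U \<subseteq> q ` topspace X \<and> openin X {x \<in> topspace X. q x \<in> U})"

lemma openin_quotient_topology:
  "openin (quotient_topology X q) U \<longleftrightarrow>
     U \<subseteq> q ` topspace X \<and> openin X {x \<in> topspace X. q x \<in> U}"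
proof -
  have "istopology (\<lambda>U. U \<subseteq> q ` topspace X \<and> openin X {x \<in> topspace X. q x \<in> U})"
    unfolding istopology_def
  proof (intro conjI allI impI)
    fix S T
    assume "S \<subseteq> q ` topspace X \<and> openin X {x \<in> topspace X. q x \<in> S}"
      and "T \<subseteq> q ` topspace X \<and> openin X {x \<in> topspace X. q x \<in> T}"
    moreover have "{x \<in> topspace X. q x \<in> S \<inter> T} =
      {x \<in> topspace X. q x \<in> S} \<inter> {x \<in> topspace X. q x \<in> T}" by blast
    ultimately show "S \<inter> T \<subseteq> q ` topspace X" "openin X {x \<in> topspace X. q x \<in> S \<inter> T}"
      by (auto simp: openin_Int)
  next
    fix K
    assume K: "\<forall>S\<in>K. S \<subseteq> q ` topspace X \<and> openin X {x \<in> topspace X. q x \<in> S}"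
    show "\<Union>K \<subseteq> q ` topspace X" using K by blast
    have "{x \<in> topspace X. q x \<in> \<Union>K} = (\<Union>S\<in>K. {x \<in> topspace X. q x \<in> S})" by blast
    then show "openin X {x \<in> topspace X. q x \<in> \<Union>K}" using K by auto
  qed
  then show ?thesis by (simp add: quotient_topology_def)
qed

lemma topspace_quotient_topology: "topspace (quotient_topology X q) = q ` topspace X"
proof (rule antisym)
  show "topspace (quotient_topology X q) \<subseteq> q ` topspace X"
    using openin_quotient_topology[of X q "topspace (quotient_topology X q)"] by simp
  have "{x \<in> topspace X. q x \<in> q ` topspace X} = topspace X" by blast
  then have "openin (quotient_topology X q) (q ` topspace X)"
    by (simp add: openin_quotient_topology)
  then show "q ` topspace X \<subseteq> topspace (quotient_topology X q)" by (rule openin_subset)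
qed

lemma quotient_map_quotient_topology: "quotient_map X (quotient_topology X q) q"
  by (simp add: quotient_map_def topspace_quotient_topology openin_quotient_topology)


section \<open>Cut and project schemes\<close>

definition additive_subgroup :: "'a::ab_group_add set \<Rightarrow> bool" where
  "additive_subgroup S \<longleftrightarrow> 0 \<in> S \<and> (\<forall>x\<in>S. \<forall>y\<in>S. x + y \<in> S) \<and> (\<forall>x\<in>S. - x \<in> S)"

text \<open>The coset of \<open>p\<close> modulo \<open>S\<close> is \<open>(+) p ` S\<close>.\<close>

definition cocompact :: "'a::{topological_space, ab_group_add} set \<Rightarrow> bool" where
  "cocompact S \<longleftrightarrow> compact_space (quotient_topology euclidean (\<lambda>p. (+) p ` S))"

definition cut_and_project_scheme ::
    "('h::{topological_ab_group_add, t2_space} \<times> 'e::euclidean_space) set \<Rightarrow> bool" where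
  "cut_and_project_scheme \<Sigma> \<longleftrightarrow>
     locally_compact_space (euclidean :: 'h topology) \<and>
     additive_subgroup \<Sigma> \<and> countable \<Sigma> \<and> discrete \<Sigma> \<and> cocompact \<Sigma> \<and>
     inj_on snd \<Sigma> \<and> closure (fst ` \<Sigma>) = UNIV"

abbreviation phys_group :: "('h \<times> 'e) set \<Rightarrow> 'e set" where
  "phys_group \<Sigma> \<equiv> snd ` \<Sigma>"

abbreviation int_group :: "('h \<times> 'e) set \<Rightarrow> 'h set" where
  "int_group \<Sigma> \<equiv> fst ` \<Sigma>"

definition star :: "('h \<times> 'e) set \<Rightarrow> 'e \<Rightarrow> 'h" where
  "star \<Sigma> \<gamma> = (THE h. (h, \<gamma>) \<in> \<Sigma>)"

text \<open>Windows are nonempty by convention: over the trivial group, the empty set would satisfy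
  the remaining conditions.\<close>

definition window :: "'h::topological_ab_group_add set \<Rightarrow> bool" where
  "window W \<longleftrightarrow> W \<noteq> {} \<and> compact W \<and> closure (interior W) = W \<and>
     (\<forall>w. (+) w ` W = W \<longrightarrow> w = 0)"

definition proj_set :: "('h \<times> 'e) set \<Rightarrow> 'h set \<Rightarrow> 'e set" where
  "proj_set \<Sigma> A = {\<gamma> \<in> phys_group \<Sigma>. star \<Sigma> \<gamma> \<in> A}"


section \<open>The hull and the internal system\<close>

definition shift :: "'e::ab_group_add \<Rightarrow> 'e set \<Rightarrow> 'e set" where
  "shift t \<Lambda> = (\<lambda>x. x + t) ` \<Lambda>"

abbreviation unshift :: "'e::ab_group_add \<Rightarrow> 'e set \<Rightarrow> 'e set" where
  "unshift t \<Lambda> \<equiv> (\<lambda>x. x - t) ` \<Lambda>"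

definition language :: "'e::euclidean_space set \<Rightarrow> 'e set set" where
  "language \<Lambda> = {unshift x \<Lambda> \<inter> ball 0 R | x R. x \<in> \<Lambda> \<and> R > 0}"

definition NS :: "('h::topological_ab_group_add \<times> 'e) set \<Rightarrow> 'h set \<Rightarrow> 'h set" where
  "NS \<Sigma> W = - {a - b | a b. a \<in> int_group \<Sigma> \<and> b \<in> frontier W}"

definition nonsingular_model_sets ::
    "('h::topological_ab_group_add \<times> 'e::euclidean_space) set \<Rightarrow> 'h set \<Rightarrow> 'e set set" where
  "nonsingular_model_sets \<Sigma> W = {unshift t (proj_set \<Sigma> ((+) w ` W)) | w t. w \<in> NS \<Sigma> W}"

text \<open>All nonsingular model sets have the same language, so this union is that common language.\<close>

definition language_NS ::
    "('h::topological_ab_group_add \<times> 'e::euclidean_space) set \<Rightarrow> 'h set \<Rightarrow> 'e set set" where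
  "language_NS \<Sigma> W = (\<Union>\<Lambda>\<in>nonsingular_model_sets \<Sigma> W. language \<Lambda>)"

definition model_hull ::
    "('h::topological_ab_group_add \<times> 'e::euclidean_space) set \<Rightarrow> 'h set \<Rightarrow> 'e set set" where
  "model_hull \<Sigma> W = {\<Lambda>. language \<Lambda> = language_NS \<Sigma> W}"

definition hull_topology ::
    "('h::topological_ab_group_add \<times> 'e::euclidean_space) set \<Rightarrow> 'h set \<Rightarrow> 'e set topology" where
  "hull_topology \<Sigma> W = nbhd_base_topology (model_hull \<Sigma> W)
     (\<lambda>\<Lambda>. {{\<Lambda>' \<in> model_hull \<Sigma> W. \<exists>t t'. norm t < \<epsilon> \<and> norm t' < \<epsilon> \<and>
                                 unshift t \<Lambda> \<inter> K = unshift t' \<Lambda>' \<inter> K}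
           | K \<epsilon>. compact K \<and> \<epsilon> > 0})"

definition internal_system ::
    "('h::topological_ab_group_add \<times> 'e::euclidean_space) set \<Rightarrow> 'h set \<Rightarrow> 'e set set" where
  "internal_system \<Sigma> W = {\<Lambda> \<in> model_hull \<Sigma> W. \<Lambda> \<subseteq> phys_group \<Sigma>}"

definition internal_topology ::
    "('h::topological_ab_group_add \<times> 'e::euclidean_space) set \<Rightarrow> 'h set \<Rightarrow> 'e set topology" where
  "internal_topology \<Sigma> W = nbhd_base_topology (internal_system \<Sigma> W)
     (\<lambda>\<Lambda>. {{\<Lambda>' \<in> internal_system \<Sigma> W. \<Lambda> \<inter> K = \<Lambda>' \<inter> K} | K. compact K})"

lemma openin_nbhd_base_topology_compact:
  fixes V :: "'a \<Rightarrow> 'e::euclidean_space set \<Rightarrow> 'a set"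
  assumes V: "\<And>x K K'. V x (K \<union> K') \<subseteq> V x K \<inter> V x K'"
  shows "openin (nbhd_base_topology X (\<lambda>x. {V x K | K. compact K})) U \<longleftrightarrow>
    U \<subseteq> X \<and> (\<forall>x\<in>U. \<exists>K. compact K \<and> V x K \<subseteq> U)"
proof -
  have "\<exists>B''\<in>{V x K | K. compact K}. B'' \<subseteq> V x K \<inter> V x K'"
    if "compact K" "compact K'" for x K K'
    using compact_Un[OF that] V[of x K K'] by blast
  then have "openin (nbhd_base_topology X (\<lambda>x. {V x K | K. compact K})) U \<longleftrightarrow>
    U \<subseteq> X \<and> (\<forall>x\<in>U. \<exists>B\<in>{V x K | K. compact K}. B \<subseteq> U)"
    by (intro openin_nbhd_base_topology) (elim CollectE exE conjE, simp only:)
  moreover have "(\<exists>B\<in>{V x K | K. compact K}. B \<subseteq> U) \<longleftrightarrow> (\<exists>K. compact K \<and> V x K \<subseteq> U)" for x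
    by blast
  ultimately show ?thesis by (simp only:)
qed

lemma openin_nbhd_base_topology_compact_real:
  fixes V :: "'a \<Rightarrow> 'e::euclidean_space set \<Rightarrow> real \<Rightarrow> 'a set"
  assumes V: "\<And>x K K' \<epsilon> \<epsilon>'. V x (K \<union> K') (min \<epsilon> \<epsilon>') \<subseteq> V x K \<epsilon> \<inter> V x K' \<epsilon>'"
  shows "openin (nbhd_base_topology X (\<lambda>x. {V x K \<epsilon> | K \<epsilon>. compact K \<and> \<epsilon> > 0})) U \<longleftrightarrow>
    U \<subseteq> X \<and> (\<forall>x\<in>U. \<exists>K \<epsilon>. compact K \<and> \<epsilon> > 0 \<and> V x K \<epsilon> \<subseteq> U)"
proof -
  have "\<exists>B''\<in>{V x K \<epsilon> | K \<epsilon>. compact K \<and> \<epsilon> > 0}. B'' \<subseteq> V x K \<epsilon> \<inter> V x K' \<epsilon>'"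
    if "compact K" "\<epsilon> > 0" "compact K'" "\<epsilon>' > 0" for x K \<epsilon> K' \<epsilon>'
  proof (rule bexI, rule V, rule CollectI, intro exI conjI)
    show "compact (K \<union> K')" using that by (simp add: compact_Un)
    show "min \<epsilon> \<epsilon>' > 0" using that by simp
  qed (rule refl)
  then have "openin (nbhd_base_topology X (\<lambda>x. {V x K \<epsilon> | K \<epsilon>. compact K \<and> \<epsilon> > 0})) U \<longleftrightarrow>
    U \<subseteq> X \<and> (\<forall>x\<in>U. \<exists>B\<in>{V x K \<epsilon> | K \<epsilon>. compact K \<and> \<epsilon> > 0}. B \<subseteq> U)"
    by (intro openin_nbhd_base_topology) (elim CollectE exE conjE, simp only:)
  moreover have "(\<exists>B\<in>{V x K \<epsilon> | K \<epsilon>. compact K \<and> \<epsilon> > 0}. B \<subseteq> U) \<longleftrightarrow>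
    (\<exists>K \<epsilon>. compact K \<and> \<epsilon> > 0 \<and> V x K \<epsilon> \<subseteq> U)" for x
    by blast
  ultimately show ?thesis by (simp only:)
qed

lemma openin_hull_topology:
  fixes \<Sigma> :: "('h::topological_ab_group_add \<times> 'e::euclidean_space) set"
  shows "openin (hull_topology \<Sigma> W) U \<longleftrightarrow> U \<subseteq> model_hull \<Sigma> W \<and>
     (\<forall>\<Lambda>\<in>U. \<exists>K \<epsilon>. compact K \<and> \<epsilon> > 0 \<and>
        {\<Lambda>' \<in> model_hull \<Sigma> W. \<exists>t t'. norm t < \<epsilon> \<and> norm t' < \<epsilon> \<and>
           unshift t \<Lambda> \<inter> K = unshift t' \<Lambda>' \<inter> K} \<subseteq> U)"
  unfolding hull_topology_def
proof (rule openin_nbhd_base_topology_compact_real, rule subsetI)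
  have restr: "A \<inter> K = B \<inter> K" "A \<inter> K' = B \<inter> K'"
    if "A \<inter> (K \<union> K') = B \<inter> (K \<union> K')" for A B K K' :: "'e set"
    using that by blast+
  fix \<Lambda> :: "'e set" and K K' \<epsilon> \<epsilon>' \<Lambda>'
  assume "\<Lambda>' \<in> {\<Lambda>' \<in> model_hull \<Sigma> W. \<exists>t t'. norm t < min \<epsilon> \<epsilon>' \<and> norm t' < min \<epsilon> \<epsilon>' \<and>
           unshift t \<Lambda> \<inter> (K \<union> K') = unshift t' \<Lambda>' \<inter> (K \<union> K')}"
  then obtain t t' where *: "\<Lambda>' \<in> model_hull \<Sigma> W" "norm t < min \<epsilon> \<epsilon>'" "norm t' < min \<epsilon> \<epsilon>'"
    "unshift t \<Lambda> \<inter> (K \<union> K') = unshift t' \<Lambda>' \<inter> (K \<union> K')"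
    unfolding mem_Collect_eq by (elim conjE exE)
  have n: "norm t < \<epsilon>" "norm t < \<epsilon>'" "norm t' < \<epsilon>" "norm t' < \<epsilon>'"
    using *(2,3) by simp_all
  show "\<Lambda>' \<in> {\<Lambda>' \<in> model_hull \<Sigma> W. \<exists>t t'. norm t < \<epsilon> \<and> norm t' < \<epsilon> \<and>
           unshift t \<Lambda> \<inter> K = unshift t' \<Lambda>' \<inter> K} \<inter>
        {\<Lambda>' \<in> model_hull \<Sigma> W. \<exists>t t'. norm t < \<epsilon>' \<and> norm t' < \<epsilon>' \<and>
           unshift t \<Lambda> \<inter> K' = unshift t' \<Lambda>' \<inter> K'}"
    by (rule IntI; rule CollectI; intro conjI exI[of _ t] exI[of _ t'];
        rule *(1) n restr[OF *(4)])
qed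

lemma openin_internal_topology:
  "openin (internal_topology \<Sigma> W) U \<longleftrightarrow> U \<subseteq> internal_system \<Sigma> W \<and>
     (\<forall>\<Lambda>\<in>U. \<exists>K. compact K \<and> {\<Lambda>' \<in> internal_system \<Sigma> W. \<Lambda> \<inter> K = \<Lambda>' \<inter> K} \<subseteq> U)"
  unfolding internal_topology_def
  by (rule openin_nbhd_base_topology_compact) blast


section \<open>Ellis semigroups\<close>

text \<open>Self-maps of a space \<open>X\<close> are functions that are extensional on \<open>topspace X\<close>, so that
  \<open>X\<^sup>X\<close> with pointwise convergence is a product topology of the library.  The action is
  given by the map \<open>act\<close>, where \<open>act t x\<close> is \<open>x.t\<close>.\<close>

definition act_map :: "'x topology \<Rightarrow> ('t \<Rightarrow> 'x \<Rightarrow> 'x) \<Rightarrow> 't \<Rightarrow> 'x \<Rightarrow> 'x" where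
  "act_map X act t = restrict (act t) (topspace X)"

definition ellis :: "'x topology \<Rightarrow> ('t \<Rightarrow> 'x \<Rightarrow> 'x) \<Rightarrow> 't set \<Rightarrow> ('x \<Rightarrow> 'x) set" where
  "ellis X act T = (product_topology (\<lambda>_. X) (topspace X)) closure_of (act_map X act ` T)"

definition ellis_topology ::
    "'x topology \<Rightarrow> ('t \<Rightarrow> 'x \<Rightarrow> 'x) \<Rightarrow> 't set \<Rightarrow> ('x \<Rightarrow> 'x) topology" where
  "ellis_topology X act T = subtopology (product_topology (\<lambda>_. X) (topspace X)) (ellis X act T)"

text \<open>Maps act on the right: \<open>g\<close> is applied first in the product of \<open>g\<close> and \<open>h\<close>.\<close>

definition ellis_semigroup ::
    "'x topology \<Rightarrow> ('t \<Rightarrow> 'x \<Rightarrow> 'x) \<Rightarrow> 't set \<Rightarrow> ('x \<Rightarrow> 'x) monoid" where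
  "ellis_semigroup X act T =
     \<lparr>carrier = ellis X act T,
      mult = (\<lambda>g h. compose (topspace X) h g),
      one = restrict id (topspace X)\<rparr>"

abbreviation hull_ellis ::
    "('h::topological_ab_group_add \<times> 'e::euclidean_space) set \<Rightarrow> 'h set \<Rightarrow>
     ('e set \<Rightarrow> 'e set) monoid" where
  "hull_ellis \<Sigma> W \<equiv> ellis_semigroup (hull_topology \<Sigma> W) unshift UNIV"

abbreviation hull_ellis_topology ::
    "('h::topological_ab_group_add \<times> 'e::euclidean_space) set \<Rightarrow> 'h set \<Rightarrow>
     ('e set \<Rightarrow> 'e set) topology" where
  "hull_ellis_topology \<Sigma> W \<equiv> ellis_topology (hull_topology \<Sigma> W) unshift UNIV"

abbreviation internal_ellis ::
    "('h::topological_ab_group_add \<times> 'e::euclidean_space) set \<Rightarrow> 'h set \<Rightarrow>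
     ('e set \<Rightarrow> 'e set) monoid" where
  "internal_ellis \<Sigma> W \<equiv> ellis_semigroup (internal_topology \<Sigma> W) shift (phys_group \<Sigma>)"

abbreviation internal_ellis_topology ::
    "('h::topological_ab_group_add \<times> 'e::euclidean_space) set \<Rightarrow> 'h set \<Rightarrow>
     ('e set \<Rightarrow> 'e set) topology" where
  "internal_ellis_topology \<Sigma> W \<equiv> ellis_topology (internal_topology \<Sigma> W) shift (phys_group \<Sigma>)"


section \<open>The suspension\<close>

definition translation_group :: "'e::ab_group_add monoid" where
  "translation_group = \<lparr>carrier = UNIV, mult = (+), one = 0\<rparr>"

definition susp_product ::
    "('h::topological_ab_group_add \<times> 'e::euclidean_space) set \<Rightarrow> 'h set \<Rightarrow>
     (('e set \<Rightarrow> 'e set) \<times> 'e) monoid" where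
  "susp_product \<Sigma> W = internal_ellis \<Sigma> W \<times>\<times> translation_group"

definition susp_diagonal ::
    "('h::topological_ab_group_add \<times> 'e::euclidean_space) set \<Rightarrow> 'h set \<Rightarrow>
     (('e set \<Rightarrow> 'e set) \<times> 'e) set" where
  "susp_diagonal \<Sigma> W = {(act_map (internal_topology \<Sigma> W) shift \<gamma>, \<gamma>) | \<gamma>. \<gamma> \<in> phys_group \<Sigma>}"

text \<open>The class of \<open>(g, t)\<close> consists of all \<open>(g.\<gamma>, t + \<gamma>)\<close>.\<close>

definition susp_class ::
    "('h::topological_ab_group_add \<times> 'e::euclidean_space) set \<Rightarrow> 'h set \<Rightarrow>
     ('e set \<Rightarrow> 'e set) \<times> 'e \<Rightarrow> (('e set \<Rightarrow> 'e set) \<times> 'e) set" where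
  "susp_class \<Sigma> W p = p <#\<^bsub>susp_product \<Sigma> W\<^esub> susp_diagonal \<Sigma> W"

text \<open>As for the quotients \<open>G Mod H\<close> of the library, classes are multiplied elementwise; the
  elements of \<open>susp_diagonal\<close> are central and form a group, so the product of the classes of
  \<open>p\<close> and \<open>q\<close> is the class of the product of \<open>p\<close> and \<open>q\<close>.\<close>

definition suspension ::
    "('h::topological_ab_group_add \<times> 'e::euclidean_space) set \<Rightarrow> 'h set \<Rightarrow>
     (('e set \<Rightarrow> 'e set) \<times> 'e) set monoid" where
  "suspension \<Sigma> W =
     \<lparr>carrier = susp_class \<Sigma> W ` carrier (susp_product \<Sigma> W),
      mult = set_mult (susp_product \<Sigma> W),
      one = susp_diagonal \<Sigma> W\<rparr>"

definition suspension_topology ::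
    "('h::topological_ab_group_add \<times> 'e::euclidean_space) set \<Rightarrow> 'h set \<Rightarrow>
     (('e set \<Rightarrow> 'e set) \<times> 'e) set topology" where
  "suspension_topology \<Sigma> W =
     quotient_topology (prod_topology (internal_ellis_topology \<Sigma> W) euclidean) (susp_class \<Sigma> W)"

text \<open>The extension of \<open>g\<close> to the hull, sending \<open>\<Lambda> - t\<close> to \<open>\<Lambda>.g - t\<close> for \<open>\<Lambda>\<close> in the internal
  system.\<close>

definition tilde ::
    "('h::topological_ab_group_add \<times> 'e::euclidean_space) set \<Rightarrow> 'h set \<Rightarrow>
     ('e set \<Rightarrow> 'e set) \<Rightarrow> 'e set \<Rightarrow> 'e set" where
  "tilde \<Sigma> W g = (\<lambda>\<Lambda>\<^sub>0\<in>model_hull \<Sigma> W.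
     THE \<Lambda>\<^sub>1. \<exists>\<Lambda>\<in>internal_system \<Sigma> W. \<exists>t. \<Lambda>\<^sub>0 = unshift t \<Lambda> \<and> \<Lambda>\<^sub>1 = unshift t (g \<Lambda>))"

end

theory Submission
  imports Defs
begin

text \<open>Cocompactness, density and local finiteness make patterns of nonsingular model sets repetitive
  with uniform gaps; hence a nonempty set belongs to the hull as soon as all its patches occur in
  nonsingular model sets.  Any \<open>\<Lambda>\<close> in the internal system projects into a compact set, so the maps
  \<open>\<Lambda> \<mapsto> \<Lambda> + \<gamma>\<close> with \<open>\<gamma>\<^sup>*\<close> in a fixed compact set form a relatively compact subset of
  \<open>E(\<Xi>\<^sup>\<Gamma>,\<Gamma>)\<close>.  By cocompactness every translation of \<open>\<real>\<^sup>d\<close> is, up to a bounded vector, one by such a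
  \<open>\<gamma>\<close>.  Therefore \<open>(g, t) \<mapsto> g\<^sup>~ - t\<close>, which is continuous, already maps a compact set onto a closed set
  containing all translations, that is onto \<open>E(\<X>,\<real>\<^sup>d)\<close>.  Its fibres are the classes of the
  suspension, so the suspension is compact, and a continuous bijection from a compact space onto a
  Hausdorff space is a homeomorphism.\<close>

section \<open>Lattice points of a cut and project scheme\<close>

text \<open>Since \<open>\<Xi>\<close> is in general only locally compact, a net of translations by
  elements of \<open>\<Gamma>\<close> need not have a limit among its self-maps. Compactness is
  recovered by applying cocompactness of the lattice to the points (0, t): the star of the lattice
  vector and the physical remainder are then bounded at the same time. Stars control patterns
  because differences of points in one hull element have stars in W - W, including for elements that
  are not model sets themselves. The algebra rests on one fact: elements of \<open>E\<Xi>\<close>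
  commute with \<open>\<Gamma>\<close>, because \<open>\<Gamma>\<close> is Abelian and membership of
  a single point is a clopen condition on \<open>\<Xi>\<close>. Two presentations of one hull
  element differ by an element of \<open>\<Gamma>\<close>; with commutation this makes the extension
  of g to the hull well defined and identifies the fibres with classes. Continuity in (g, t) is
  tested at one hull element at a time, where only the value of g at one representative in
  \<open>\<Xi>\<close> enters. A subtlety in describing the hull is that a language lists patches
  without their radii.\<close>

locale cut_and_project =
  fixes \<Sigma> :: "('h::{topological_ab_group_add, t2_space} \<times> 'e::euclidean_space) set"
    and W :: "'h set"
  assumes scheme: "cut_and_project_scheme \<Sigma>" and window: "window W"
begin

definition "\<Gamma> = phys_group \<Sigma>"
abbreviation "st \<equiv> star \<Sigma>"
abbreviation "P \<equiv> proj_set \<Sigma>"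

section \<open>Arithmetic of the star map\<close>

lemma star_eq: "(h, \<gamma>) \<in> \<Sigma> \<Longrightarrow> st \<gamma> = h"
  using scheme inj_onD[of snd \<Sigma> "(h, \<gamma>)"] unfolding star_def cut_and_project_scheme_def
  by (intro the_equality) auto

lemma in_groupI: "(h, \<gamma>) \<in> \<Sigma> \<Longrightarrow> \<gamma> \<in> \<Gamma>"
  unfolding \<Gamma>_def by force

lemma star_in: "\<gamma> \<in> \<Gamma> \<Longrightarrow> (st \<gamma>, \<gamma>) \<in> \<Sigma>"
  using star_eq unfolding \<Gamma>_def by force

lemma lattice_subgroup: "additive_subgroup \<Sigma>"
  using scheme by (simp add: cut_and_project_scheme_def)

lemma zero_in [simp]: "0 \<in> \<Gamma>" and star_zero [simp]: "st 0 = 0"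
proof -
  have "(0, 0) \<in> \<Sigma>" using lattice_subgroup by (simp add: additive_subgroup_def zero_prod_def)
  then show "0 \<in> \<Gamma>" "st 0 = 0" by (rule in_groupI, rule star_eq)
qed

lemma add_in: "x \<in> \<Gamma> \<Longrightarrow> y \<in> \<Gamma> \<Longrightarrow> x + y \<in> \<Gamma>"
  and star_add: "x \<in> \<Gamma> \<Longrightarrow> y \<in> \<Gamma> \<Longrightarrow> st (x + y) = st x + st y"
proof -
  assume "x \<in> \<Gamma>" "y \<in> \<Gamma>"
  then have "(st x, x) + (st y, y) \<in> \<Sigma>"
    using lattice_subgroup star_in unfolding additive_subgroup_def by blast
  then have "(st x + st y, x + y) \<in> \<Sigma>" by simp
  then show "x + y \<in> \<Gamma>" "st (x + y) = st x + st y" by (rule in_groupI, rule star_eq)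
qed

lemma minus_in: "x \<in> \<Gamma> \<Longrightarrow> - x \<in> \<Gamma>" and star_minus: "x \<in> \<Gamma> \<Longrightarrow> st (- x) = - st x"
proof -
  assume "x \<in> \<Gamma>"
  then have "- (st x, x) \<in> \<Sigma>"
    using lattice_subgroup star_in unfolding additive_subgroup_def by blast
  then have "(- st x, - x) \<in> \<Sigma>" by simp
  then show "- x \<in> \<Gamma>" "st (- x) = - st x" by (rule in_groupI, rule star_eq)
qed

lemma diff_in: "x \<in> \<Gamma> \<Longrightarrow> y \<in> \<Gamma> \<Longrightarrow> x - y \<in> \<Gamma>"
  and star_diff: "x \<in> \<Gamma> \<Longrightarrow> y \<in> \<Gamma> \<Longrightarrow> st (x - y) = st x - st y"
  using add_in[of x "- y"] star_add[of x "- y"] minus_in[of y] star_minus[of y] by auto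

lemma star_dense:
  assumes "open U" "U \<noteq> {}"
  obtains \<gamma> where "\<gamma> \<in> \<Gamma>" "st \<gamma> \<in> U"
proof -
  have "closure (int_group \<Sigma>) = UNIV" using scheme by (simp add: cut_and_project_scheme_def)
  then have "U \<inter> int_group \<Sigma> \<noteq> {}" using assms open_Int_closure_eq_empty[of U] by blast
  then obtain h \<gamma> where "h \<in> U" "(h, \<gamma>) \<in> \<Sigma>" by auto
  then show ?thesis using that[of \<gamma>] star_eq in_groupI by force
qed

lemma mem_proj: "x \<in> P A \<longleftrightarrow> x \<in> \<Gamma> \<and> st x \<in> A"
  by (auto simp: proj_set_def \<Gamma>_def)

section \<open>Discreteness and cocompactness of the lattice\<close>

lemma lattice_separated:
  obtains O\<^sub>0 \<epsilon> where "open O\<^sub>0" "0 \<in> O\<^sub>0" "\<epsilon> > (0::real)"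
    "\<And>\<gamma>. \<gamma> \<in> \<Gamma> \<Longrightarrow> st \<gamma> \<in> O\<^sub>0 \<Longrightarrow> norm \<gamma> < \<epsilon> \<Longrightarrow> \<gamma> = 0"
proof -
  have "(0, 0) \<in> \<Sigma>" using lattice_subgroup by (simp add: additive_subgroup_def zero_prod_def)
  moreover have "discrete \<Sigma>" using scheme by (simp add: cut_and_project_scheme_def)
  ultimately obtain T where T: "open T" "T \<inter> \<Sigma> = {(0, 0)}"
    unfolding discrete_def isolated_in_def by blast
  then obtain A B where AB: "open A" "open B" "(0, 0) \<in> A \<times> B" "A \<times> B \<subseteq> T"
    using open_prod_elim[of T "(0, 0)"] by blast
  then obtain \<epsilon> where \<epsilon>: "\<epsilon> > 0" "ball 0 \<epsilon> \<subseteq> B" by (metis mem_Sigma_iff openE)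
  have "\<gamma> = 0" if "\<gamma> \<in> \<Gamma>" "st \<gamma> \<in> A" "norm \<gamma> < \<epsilon>" for \<gamma>
  proof -
    have "\<gamma> \<in> B" using \<epsilon>(2) that(3) by auto
    then have "(st \<gamma>, \<gamma>) \<in> T \<inter> \<Sigma>" using AB(4) star_in[OF that(1)] that(2) by blast
    then show ?thesis using T(2) by simp
  qed
  then show ?thesis using that[of A \<epsilon>] AB \<epsilon>(1) by auto
qed

text \<open>Two elements of \<open>\<Gamma>\<close> that are close in both coordinates differ by a
  lattice vector near 0, hence coincide by \<open>lattice_separated\<close>. Compactness covers
  \<open>C\<close> and the ball by finitely many small sets, and each product box contains at most
  one lattice point.\<close>

lemma locally_finite:
  assumes "compact C"
  shows "finite {\<gamma> \<in> P C. norm \<gamma> \<le> R}"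
proof -
  obtain O\<^sub>0 \<epsilon> where O: "open O\<^sub>0" "0 \<in> O\<^sub>0" "\<epsilon> > (0::real)"
    "\<And>\<gamma>. \<gamma> \<in> \<Gamma> \<Longrightarrow> st \<gamma> \<in> O\<^sub>0 \<Longrightarrow> norm \<gamma> < \<epsilon> \<Longrightarrow> \<gamma> = 0"
    using lattice_separated by blast
  have ex: "\<exists>N. open N \<and> h \<in> N \<and> (\<forall>x\<in>N. \<forall>y\<in>N. x - y \<in> O\<^sub>0)" for h
  proof -
    have "open ((\<lambda>p::'h \<times> 'h. fst p - snd p) -` O\<^sub>0)"
      by (intro open_vimage O continuous_intros)
    moreover have "(h, h) \<in> (\<lambda>p. fst p - snd p) -` O\<^sub>0" using O(2) by simp
    ultimately obtain A B where "open A" "open B" "(h, h) \<in> A \<times> B"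
        "A \<times> B \<subseteq> (\<lambda>p. fst p - snd p) -` O\<^sub>0"
      by (rule open_prod_elim)
    moreover from this have "\<forall>x\<in>A \<inter> B. \<forall>y\<in>A \<inter> B. x - y \<in> O\<^sub>0" by fastforce
    ultimately show ?thesis by (intro exI[of _ "A \<inter> B"]) auto
  qed
  then obtain N where N: "\<And>h. open (N h)" "\<And>h. h \<in> N h"
      "\<And>h x y. x \<in> N h \<Longrightarrow> y \<in> N h \<Longrightarrow> x - y \<in> O\<^sub>0"
    by metis
  obtain D where D: "finite D" "C \<subseteq> (\<Union>h\<in>D. N h)"
  proof (rule compactE_image[OF assms])
    show "C \<subseteq> (\<Union>h\<in>UNIV. N h)" using N(2) by auto
  qed (auto intro: N(1))
  \<comment> \<open>Radius \<open>\<epsilon> / 2\<close>, so that two points of the same ball are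
    less than \<open>\<epsilon>\<close> apart.\<close>
  obtain B :: "'e set" where B: "finite B" "cball 0 R \<subseteq> (\<Union>b\<in>B. ball b (\<epsilon> / 2))"
  proof (rule compactE_image[OF compact_cball])
    show "cball 0 R \<subseteq> (\<Union>b\<in>UNIV. ball b (\<epsilon> / 2))"
    proof
      fix x show "x \<in> (\<Union>b\<in>UNIV. ball b (\<epsilon> / 2))"
        using O(3) by (intro UN_I[of x]) auto
    qed
  qed auto
  let ?S = "\<lambda>h b. {\<gamma> \<in> \<Gamma>. st \<gamma> \<in> N h \<and> \<gamma> \<in> ball b (\<epsilon> / 2)}"
  have "finite (?S h b)" for h b
  proof -
    have "x = y" if "x \<in> ?S h b" "y \<in> ?S h b" for x y
    proof -
      have "dist x y < \<epsilon>" using that dist_triangle_half_r[of b x \<epsilon> y] by auto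
      then have "x - y = 0"
        using that by (intro O(4)) (auto simp: diff_in star_diff dist_norm intro: N(3))
      then show ?thesis by simp
    qed
    then have "?S h b \<subseteq> {x}" if "x \<in> ?S h b" for x using that by blast
    then show ?thesis
      by (metis (lifting) equals0I finite.emptyI finite.insertI finite_subset)
  qed
  then have "finite (\<Union>h\<in>D. \<Union>b\<in>B. ?S h b)" using D B by blast
  moreover have "{\<gamma> \<in> P C. norm \<gamma> \<le> R} \<subseteq> (\<Union>h\<in>D. \<Union>b\<in>B. ?S h b)"
  proof
    fix \<gamma> assume \<gamma>: "\<gamma> \<in> {\<gamma> \<in> P C. norm \<gamma> \<le> R}"
    obtain h where "h \<in> D" "st \<gamma> \<in> N h" using \<gamma> D(2) by (auto simp: mem_proj)
    moreover obtain b where "b \<in> B" "\<gamma> \<in> ball b (\<epsilon> / 2)" using \<gamma> B(2) by fastforce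
    ultimately show "\<gamma> \<in> (\<Union>h\<in>D. \<Union>b\<in>B. ?S h b)" using \<gamma> by (auto simp: mem_proj)
  qed
  ultimately show ?thesis by (rule finite_subset[rotated])
qed

text \<open>Cocompactness in usable form: the images of relatively compact open boxes form an open
  cover of the quotient, so finitely many boxes represent all cosets. The remainder of (h, y) modulo
  the lattice then lies in one of these boxes.\<close>

lemma fundamental_domain:
  obtains K :: "'h set" and \<rho> where "compact K"
    "\<And>h y. \<exists>\<gamma>\<in>\<Gamma>. h - st \<gamma> \<in> K \<and> norm (y - \<gamma>) \<le> \<rho>"
proof -
  define q where "q = (\<lambda>p. (+) p ` \<Sigma>)"
  have "\<exists>U C. open U \<and> compact C \<and> h \<in> U \<and> U \<subseteq> C" for h :: 'h
    using scheme unfolding cut_and_project_scheme_def locally_compact_space_def by simp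
  then obtain U C where UC: "\<And>h::'h. open (U h)" "\<And>h. compact (C h)" "\<And>h. h \<in> U h"
      "\<And>h. U h \<subseteq> C h"
    by metis
  have coset_eq: "q x = q y \<longleftrightarrow> x - y \<in> \<Sigma>" for x y
  proof
    assume "q x = q y"
    moreover have "x + 0 \<in> q x"
      using lattice_subgroup unfolding q_def additive_subgroup_def by blast
    ultimately obtain s where "s \<in> \<Sigma>" "x + 0 = y + s" unfolding q_def by blast
    then show "x - y \<in> \<Sigma>" by (simp add: algebra_simps)
  next
    have sub: "q a \<subseteq> q b" if ab: "a - b \<in> \<Sigma>" for a b
    proof
      fix z assume "z \<in> q a"
      then obtain s where "s \<in> \<Sigma>" "z = b + ((a - b) + s)" unfolding q_def by force
      then show "z \<in> q b"
        using ab lattice_subgroup unfolding q_def additive_subgroup_def by blast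
    qed
    assume *: "x - y \<in> \<Sigma>"
    then have "- (x - y) \<in> \<Sigma>" using lattice_subgroup unfolding additive_subgroup_def by blast
    then show "q x = q y" using sub[OF *] sub[of y x] by simp
  qed
  define V where "V = (\<lambda>p. q ` (U (fst p) \<times> ball (snd p) 1))"
  have "compact_space (quotient_topology euclidean q)"
    using scheme unfolding cut_and_project_scheme_def cocompact_def q_def by simp
  moreover have "openin (quotient_topology euclidean q) (V p)" for p
  proof -
    have tr: "open ((\<lambda>x. x - s) -` T)" if "open T" for T and s :: "'h \<times> 'e"
    proof -
      have "continuous_on UNIV (\<lambda>x::'h \<times> 'e. (fst x - fst s, snd x - snd s))"
        by (intro continuous_intros)
      then have "continuous_on UNIV (\<lambda>x. x - s)"
        by (simp add: minus_prod_def)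
      with that show ?thesis by (rule open_vimage)
    qed
    \<comment> \<open>The preimage of the image of a box is the union of its lattice translates;
      hence the image is open in the quotient.\<close>
    have "{x. q x \<in> V p} = (\<Union>s\<in>\<Sigma>. (\<lambda>x. x - s) -` (U (fst p) \<times> ball (snd p) 1))"
      (is "_ = ?R")
    proof (intro Set.set_eqI iffI)
      fix x assume "x \<in> {x. q x \<in> V p}"
      then obtain u where u: "u \<in> U (fst p) \<times> ball (snd p) 1" "x - u \<in> \<Sigma>"
        unfolding V_def by (auto simp: coset_eq)
      show "x \<in> ?R"
      proof (rule UN_I[OF u(2)])
        have "x - (x - u) = u" by (simp only: diff_diff_eq2 add_diff_cancel_left')
        then show "x \<in> (\<lambda>z. z - (x - u)) -` (U (fst p) \<times> ball (snd p) 1)"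
          using u(1) by (simp only: vimage_eq)
      qed
    next
      fix x assume "x \<in> ?R"
      then obtain s where "s \<in> \<Sigma>" and "x \<in> (\<lambda>z. z - s) -` (U (fst p) \<times> ball (snd p) 1)"
        by (rule UN_E)
      then have "x - s \<in> U (fst p) \<times> ball (snd p) 1" by (simp only: vimage_eq)
      moreover have "q x = q (x - s)"
        unfolding coset_eq using \<open>s \<in> \<Sigma>\<close> by (simp only: diff_diff_eq2 add_diff_cancel_left')
      ultimately have "q x \<in> V p" unfolding V_def by (simp only: imageI)
      then show "x \<in> {x. q x \<in> V p}" by simp
    qed
    also have "open \<dots>" by (intro open_UN ballI tr open_Times UC(1) open_ball)
    finally have "open {x. q x \<in> V p}" .
    moreover have "V p \<subseteq> range q" unfolding V_def by blast
    ultimately show ?thesis by (simp add: openin_quotient_topology)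
  qed
  moreover have "q p \<in> V p" for p
    unfolding V_def using UC(3)[of "fst p"] by (intro imageI) (auto simp: mem_Times_iff)
  ultimately have "\<exists>F. finite F \<and> range q \<subseteq> (\<Union>p\<in>F. V p)"
  proof -
    assume c: "compact_space (quotient_topology euclidean q)"
      and o: "\<And>p. openin (quotient_topology euclidean q) (V p)" and i: "\<And>p. q p \<in> V p"
    have ts: "topspace (quotient_topology euclidean q) = range q"
      by (simp add: topspace_quotient_topology)
    have "Ball (range V) (openin (quotient_topology euclidean q)) \<and>
        range q \<subseteq> \<Union>(range V)"
      using o i by blast
    with c obtain \<F> where "finite \<F>" "\<F> \<subseteq> range V" "range q \<subseteq> \<Union>\<F>"
      unfolding compact_space_alt ts by metis
    then show ?thesis by (metis finite_subset_image)
  qed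
  then obtain F where F: "finite F" "range q \<subseteq> (\<Union>p\<in>F. V p)"
    by blast
  show ?thesis
  proof (rule that)
    \<comment> \<open>\<open>K\<close> is the union of the compact neighbourhoods at the finitely
      many centres; the sum over \<open>F\<close> serves as a common bound for the physical parts of
      the boxes, each of which has radius 1.\<close>
    show "compact (\<Union>p\<in>F. C (fst p))" using F(1) UC(2) by blast
    fix h y
    obtain p u where p: "p \<in> F" "u \<in> U (fst p) \<times> ball (snd p) 1" "q (h, y) = q u"
      using F(2) unfolding V_def by blast
    from p(3) have s: "(h, y) - u \<in> \<Sigma>" by (simp add: coset_eq)
    define \<gamma> where "\<gamma> = y - snd u"
    have s': "(h - fst u, \<gamma>) \<in> \<Sigma>" using s by (simp add: \<gamma>_def minus_prod_def)
    have "\<gamma> \<in> \<Gamma>" using s' by (rule in_groupI)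
    moreover have "h - st \<gamma> = fst u" using star_eq[OF s'] by simp
    then have "h - st \<gamma> \<in> C (fst p)" using p(2) subsetD[OF UC(4)[of "fst p"]] by (auto simp: mem_Times_iff)
    then have "h - st \<gamma> \<in> (\<Union>p\<in>F. C (fst p))" using p(1) by (rule UN_I[rotated])
    moreover have "norm (y - \<gamma>) \<le> (\<Sum>p\<in>F. norm (snd p) + 1)"
    proof -
      have "norm (y - \<gamma>) \<le> norm (snd p) + dist (snd p) (snd u)"
        using norm_triangle_ineq2[of "snd u" "snd p"]
        by (simp add: \<gamma>_def dist_norm norm_minus_commute)
      also have "\<dots> \<le> norm (snd p) + 1" using p(2) by (auto simp: mem_Times_iff)
      also have "\<dots> \<le> (\<Sum>p\<in>F. norm (snd p) + 1)"
        using F(1) p(1) by (intro member_le_sum) auto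
      finally show ?thesis .
    qed
    ultimately show "\<exists>\<gamma>\<in>\<Gamma>. h - st \<gamma> \<in> (\<Union>p\<in>F. C (fst p)) \<and>
        norm (y - \<gamma>) \<le> (\<Sum>p\<in>F. norm (snd p) + 1)"
      by blast
  qed
qed

text \<open>Density of the stars with gaps that are bounded uniformly in \<open>h\<close> and
  \<open>y\<close>: \<open>fundamental_domain\<close> first brings \<open>h\<close> into the compact
  set \<open>K\<close>, close to \<open>y\<close>, and a second lattice vector from a finite list
  then reaches \<open>U\<close>.\<close>

lemma dense_bounded:
  assumes "open U" "U \<noteq> {}"
  obtains \<rho> where "\<And>h y. \<exists>\<gamma>\<in>\<Gamma>. st \<gamma> - h \<in> U \<and> norm (y - \<gamma>) \<le> \<rho>"
proof -
  obtain K \<rho> where K: "compact K" "\<And>h y. \<exists>\<gamma>\<in>\<Gamma>. h - st \<gamma> \<in> K \<and> norm (y - \<gamma>) \<le> \<rho>"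
    using fundamental_domain by metis
  have op: "open ((\<lambda>c. st \<delta> - c) -` U)" for \<delta>
    by (intro open_vimage assms continuous_intros)
  have "\<exists>\<delta>\<in>\<Gamma>. st \<delta> - c \<in> U" for c
  proof -
    have "open ((\<lambda>x. x - c) -` U)" by (intro open_vimage assms continuous_intros)
    moreover have "(\<lambda>x. x - c) -` U \<noteq> {}"
    proof -
      obtain u where "u \<in> U" using assms by blast
      then have "u + c \<in> (\<lambda>x. x - c) -` U" by simp
      then show ?thesis by blast
    qed
    ultimately show ?thesis by (meson star_dense vimageE)
  qed
  \<comment> \<open>For fixed \<open>\<delta>\<close> the points \<open>c\<close> that
    \<open>\<delta>\<close> carries into \<open>U\<close> form an open set, so finitely many
    \<open>\<delta>\<close> serve all of \<open>K\<close>. Their norms, summed, are the increase of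
    \<open>\<rho>\<close>.\<close>
  then have "K \<subseteq> (\<Union>\<delta>\<in>\<Gamma>. (\<lambda>c. st \<delta> - c) -` U)" by blast
  then obtain F where F: "F \<subseteq> \<Gamma>" "finite F" "K \<subseteq> (\<Union>\<delta>\<in>F. (\<lambda>c. st \<delta> - c) -` U)"
    using compactE_image[OF K(1), of \<Gamma> "\<lambda>\<delta>. (\<lambda>c. st \<delta> - c) -` U"] op by blast
  show ?thesis
  proof (rule that)
    fix h y
    obtain \<gamma> where \<gamma>: "\<gamma> \<in> \<Gamma>" "h - st \<gamma> \<in> K" "norm (y - \<gamma>) \<le> \<rho>" using K(2) by blast
    then obtain \<delta> where \<delta>: "\<delta> \<in> F" "st \<delta> - (h - st \<gamma>) \<in> U" using F(3) by auto
    have "norm (y - (\<gamma> + \<delta>)) \<le> norm (y - \<gamma>) + norm \<delta>"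
      using norm_triangle_ineq4[of "y - \<gamma>" \<delta>] by (simp add: algebra_simps)
    moreover have "norm \<delta> \<le> (\<Sum>\<delta>\<in>F. norm \<delta>)" using F \<delta>(1) by (intro member_le_sum) auto
    moreover have "st (\<gamma> + \<delta>) - h = st \<delta> - (h - st \<gamma>)"
      using \<gamma> \<delta> F by (auto simp: star_add subset_iff)
    moreover have "\<gamma> + \<delta> \<in> \<Gamma>" using \<gamma>(1) \<delta>(1) F(1) by (auto intro: add_in)
    ultimately show "\<exists>\<gamma>\<in>\<Gamma>. st \<gamma> - h \<in> U \<and> norm (y - \<gamma>) \<le> \<rho> + (\<Sum>\<delta>\<in>F. norm \<delta>)"
      using \<gamma>(3) \<delta>(2) by (intro bexI[of _ "\<gamma> + \<delta>"] conjI) (metis, linarith)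
  qed
qed

end

section \<open>Patches and the hull\<close>

lemma mem_unshift: "y \<in> unshift t \<Lambda> \<longleftrightarrow> y + t \<in> \<Lambda>"
  by (auto simp: image_iff algebra_simps)

lemma mem_shift: "y \<in> shift t \<Lambda> \<longleftrightarrow> y - t \<in> \<Lambda>"
  unfolding shift_def image_iff by (metis add_diff_cancel diff_add_cancel)

lemma unshift_unshift: "unshift s (unshift t \<Lambda>) = unshift (s + t) \<Lambda>"
  unfolding set_eq_iff mem_unshift by (simp add: algebra_simps)

lemma unshift_shift: "unshift s (shift t \<Lambda>) = unshift (s - t) \<Lambda>"
  unfolding set_eq_iff mem_unshift mem_shift by (simp add: algebra_simps)

lemma shift_eq_unshift: "shift t \<Lambda> = unshift (- t) \<Lambda>"
  by (simp add: shift_def)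

definition patch :: "real \<Rightarrow> 'e::euclidean_space set \<Rightarrow> 'e \<Rightarrow> 'e set" where
  "patch R \<Lambda> x = unshift x \<Lambda> \<inter> ball 0 R"

lemma mem_patch: "v \<in> patch R \<Lambda> x \<longleftrightarrow> x + v \<in> \<Lambda> \<and> norm v < R"
  by (auto simp: patch_def mem_unshift add.commute)

lemma patch_unshift: "patch R (unshift t \<Lambda>) x = patch R \<Lambda> (x + t)"
  by (auto simp: mem_patch mem_unshift algebra_simps)

lemma language_eq: "language \<Lambda> = {patch R \<Lambda> x | x R. x \<in> \<Lambda> \<and> R > 0}"
  by (simp add: language_def patch_def)

lemma language_unshift: "language (unshift t \<Lambda>) = language \<Lambda>"
proof -
  have sub: "language (unshift t \<Lambda>) \<subseteq> language \<Lambda>" for t and \<Lambda> :: "'a set"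
    unfolding language_eq patch_unshift mem_unshift by blast
  have "unshift (- t) (unshift t \<Lambda>) = \<Lambda>" unfolding unshift_unshift by simp
  with sub[of "- t" "unshift t \<Lambda>"] sub[of t \<Lambda>] show ?thesis by simp
qed

context cut_and_project
begin

abbreviation "\<X> \<equiv> model_hull \<Sigma> W"
abbreviation "\<Xi> \<equiv> internal_system \<Sigma> W"

definition model_set :: "'h \<Rightarrow> 'e set" where
  "model_set w = P ((+) w ` W)"

text \<open>This set contains the stars of all differences of two points of one model set,
  independently of the parameter w. The image form yields compactness at once.\<close>

definition W_diff :: "'h set" where
  "W_diff = (\<lambda>p. fst p - snd p) ` (W \<times> W)"

lemma W_diffI: "h = a - b \<Longrightarrow> a \<in> W \<Longrightarrow> b \<in> W \<Longrightarrow> h \<in> W_diff"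
  unfolding W_diff_def by force

lemma mem_model_set: "x \<in> model_set w \<longleftrightarrow> x \<in> \<Gamma> \<and> st x - w \<in> W"
  unfolding model_set_def mem_proj by (metis add_diff_cancel_left' diff_add_cancel add.commute imageE imageI)

lemma compact_W: "compact W" and interior_W: "interior W \<noteq> {}"
  using window unfolding window_def by auto

lemma compact_W_diff: "compact W_diff"
  unfolding W_diff_def
  by (intro compact_continuous_image compact_Times compact_W continuous_intros)

section \<open>Nonsingular model sets and their repetitivity\<close>

lemma mem_NS: "w \<in> NS \<Sigma> W \<longleftrightarrow> (\<forall>\<gamma>\<in>\<Gamma>. st \<gamma> - w \<notin> frontier W)"
proof
  assume w: "w \<in> NS \<Sigma> W"
  show "\<forall>\<gamma>\<in>\<Gamma>. st \<gamma> - w \<notin> frontier W"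
  proof (intro ballI notI)
    fix \<gamma> assume *: "\<gamma> \<in> \<Gamma>" "st \<gamma> - w \<in> frontier W"
    have "st \<gamma> \<in> int_group \<Sigma>" using star_in[OF *(1)] by force
    moreover have "w = st \<gamma> - (st \<gamma> - w)" by simp
    ultimately show False using w *(2) unfolding NS_def by blast
  qed
next
  assume *: "\<forall>\<gamma>\<in>\<Gamma>. st \<gamma> - w \<notin> frontier W"
  show "w \<in> NS \<Sigma> W"
    unfolding NS_def
  proof (intro ComplI notI, elim CollectE exE conjE)
    fix a b assume w: "w = a - b" and "a \<in> int_group \<Sigma>" and b: "b \<in> frontier W"
    then obtain \<gamma> where \<gamma>: "(a, \<gamma>) \<in> \<Sigma>" by auto
    have "st \<gamma> - w = b" by (simp add: w star_eq[OF \<gamma>])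
    then show False using * b in_groupI[OF \<gamma>] by metis
  qed
qed

text \<open>By Baire's theorem, because the boundary of the window is closed with empty interior.\<close>

lemma nonsingular_exists: "\<exists>w. w \<in> NS \<Sigma> W"
proof -
  define G where "G = (\<lambda>\<gamma>. (\<lambda>h. st \<gamma> - h) -` frontier W) ` \<Gamma>"
  have lc: "locally_compact_space (euclidean :: 'h topology)"
    using scheme by (simp add: cut_and_project_scheme_def)
  have cl: "closed W" using compact_W by (rule compact_imp_closed)
  have t2: "Hausdorff_space (euclidean :: 'h topology)"
    unfolding Hausdorff_space_def disjnt_def using hausdorff by (simp, metis)
  have "euclidean interior_of \<Union>G = {}"
  proof (rule Baire_category_alt)
    show "completely_metrizable_space (euclidean :: 'h topology) \<or>
        locally_compact_space (euclidean :: 'h topology) \<and> regular_space (euclidean :: 'h topology)"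
      using lc locally_compact_Hausdorff_imp_regular_space[OF lc] t2 by blast
    show "countable G"
      using scheme unfolding G_def \<Gamma>_def cut_and_project_scheme_def by blast
    fix T assume "T \<in> G"
    then obtain \<gamma> where T: "T = (\<lambda>h. st \<gamma> - h) -` frontier W" unfolding G_def by blast
    have "closed T" unfolding T by (intro closed_vimage continuous_intros frontier_closed)
    moreover have "interior T = {}"
    proof (rule ccontr)
      assume "interior T \<noteq> {}"
      then obtain h where h: "h \<in> interior T" by blast
      \<comment> \<open>The reflection at \<open>st \<gamma>\<close> turns the interior of
        \<open>T\<close> into an open part of the boundary. As \<open>W\<close> is closed, such a
        part lies in \<open>W\<close>, hence in its interior, which is disjoint from the
        boundary.\<close>
      define V where "V = (\<lambda>h. st \<gamma> - h) -` interior T"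
      have "open V" unfolding V_def by (intro open_vimage open_interior continuous_intros)
      moreover have V: "V \<subseteq> frontier W"
      proof
        fix v assume "v \<in> V"
        then have "st \<gamma> - v \<in> T" using interior_subset unfolding V_def by blast
        then show "v \<in> frontier W" by (simp add: T)
      qed
      moreover from this cl have "V \<subseteq> W" using frontier_subset_closed by blast
      ultimately have "V \<subseteq> interior W" by (simp add: interior_maximal)
      moreover have "st \<gamma> - h \<in> V" using h by (simp add: V_def)
      ultimately show False using V unfolding frontier_def by blast
    qed
    ultimately show "closedin euclidean T \<and> euclidean interior_of T = {}" by simp
  qed
  then have "\<Union>G \<noteq> UNIV" by auto
  then obtain w where "w \<notin> \<Union>G" by blast
  then have "w \<in> NS \<Sigma> W" unfolding mem_NS G_def by auto
  then show ?thesis ..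
qed

text \<open>A patch of radius \<open>R\<close> is decided by finitely many vectors u, those in
  \<open>P W_diff\<close> of norm at most \<open>R\<close>. For nonsingular \<open>w\<close> a
  present point has its star in the interior of the window, and an absent one has it outside the
  closed window; both are open conditions on the star of the centre. The parameter \<open>w'\<close>
  enters only through the difference \<open>st x - w'\<close>, so it may be arbitrary.\<close>

lemma patch_acceptance_domain:
  assumes w: "w \<in> NS \<Sigma> W" and z: "z \<in> model_set w"
  obtains U where "open U" "st z - w \<in> U"
    "\<And>x w'. x \<in> \<Gamma> \<Longrightarrow> st x - w' \<in> U \<Longrightarrow>
      x \<in> model_set w' \<and> patch R (model_set w') x = patch R (model_set w) z"
proof -
  let ?p = "patch R (model_set w) z"
  let ?F = "{\<gamma> \<in> P W_diff. norm \<gamma> \<le> R}"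
  have fin: "finite ?F" by (rule locally_finite[OF compact_W_diff])
  have cl: "closed W" using compact_W by (rule compact_imp_closed)
  have diff: "u \<in> ?F" if "norm u < R" "x \<in> model_set v" "x + u \<in> model_set v" for u x v
  proof -
    have "u = (x + u) - x" by simp
    then have u: "u \<in> \<Gamma>" "st u = st (x + u) - st x"
      using that diff_in star_diff mem_model_set by metis+
    have "st u = (st (x + u) - v) - (st x - v)" using u(2) by simp
    then have "st u \<in> W_diff"
      using that(2,3) unfolding mem_model_set by (blast intro: W_diffI)
    then show ?thesis using that u(1) by (simp add: mem_proj)
  qed
  have zG: "z \<in> \<Gamma>" "st z - w \<in> W" using z by (auto simp: mem_model_set)
  have p_sub: "?p \<subseteq> ?F" using diff z by (auto simp: mem_patch)
  \<comment> \<open>Three groups of conditions: the centre belongs to the set, each point of the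
    patch is present, each other candidate of norm below \<open>R\<close> is absent.\<close>
  define U where "U = interior W \<inter> (\<Inter>u\<in>?p. (\<lambda>h. h + st u) -` interior W) \<inter>
      (\<Inter>u\<in>{u \<in> ?F - ?p. norm u < R}. (\<lambda>h. h + st u) -` (- W))"
  have int: "st x - w \<in> interior W" if "x \<in> model_set w" for x
    using that w cl unfolding mem_NS mem_model_set frontier_def by auto
  show ?thesis
  proof (rule that)
    show "open U"
      unfolding U_def using cl
      by (intro open_Int open_INT open_interior finite_subset[OF p_sub fin] finite_subset[OF _ fin])
        (auto intro!: open_vimage continuous_intros)
    have add: "st z - w + st u \<in> A \<longleftrightarrow> st (z + u) - w \<in> A" if "u \<in> ?F" for u A
      using that zG(1) by (simp add: star_add mem_proj algebra_simps)
    have "st z - w + st u \<in> interior W" if "u \<in> ?p" for u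
      using that add[of u] p_sub int[of "z + u"] by (auto simp: mem_patch)
    moreover have "st z - w + st u \<notin> W" if "u \<in> ?F - ?p" "norm u < R" for u
      using that add[of u] zG(1) by (simp add: mem_patch mem_model_set mem_proj add_in)
    ultimately show "st z - w \<in> U"
      using int[OF z] unfolding U_def by (intro IntI INT_I) simp_all
    fix x w' assume x: "x \<in> \<Gamma>" and xU: "st x - w' \<in> U"
    have st_add: "st (x + u) - w' = st x - w' + st u" if "u \<in> ?F" for u
      using that x by (simp add: star_add mem_proj)
    have "st x - w' \<in> interior W" using xU unfolding U_def by blast
    then have x_in: "x \<in> model_set w'" using x interior_subset by (auto simp: mem_model_set)
    moreover have "patch R (model_set w') x = ?p"
    proof (intro Set.set_eqI iffI)
      fix u assume u: "u \<in> patch R (model_set w') x"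
      then have uF: "u \<in> ?F" using diff[OF _ x_in] by (auto simp: mem_patch)
      show "u \<in> ?p"
      proof (rule ccontr)
        assume "u \<notin> ?p"
        then have "st x - w' + st u \<notin> W" using xU uF u unfolding U_def
          by (auto simp: mem_patch)
        then show False using u uF by (auto simp: mem_patch mem_model_set st_add)
      qed
    next
      fix u assume u: "u \<in> ?p"
      then have uF: "u \<in> ?F" using p_sub by blast
      have "st x - w' + st u \<in> interior W" using u xU unfolding U_def by blast
      then have "st (x + u) - w' \<in> W" unfolding st_add[OF uF] using interior_subset by blast
      then show "u \<in> patch R (model_set w') x"
        using u uF x by (simp add: mem_patch mem_model_set mem_proj add_in)
    qed
    ultimately show "x \<in> model_set w' \<and> patch R (model_set w') x = ?p" ..
  qed
qed

text \<open>Apply \<open>dense_bounded\<close> to the acceptance domain. Its bound is uniform in the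
  offset \<open>h\<close>, here \<open>w'\<close>, so one radius works for all model sets
  simultaneously.\<close>

lemma model_set_repetitive:
  assumes "w \<in> NS \<Sigma> W" "z \<in> model_set w"
  obtains \<rho> where "\<And>w' y. \<exists>x\<in>model_set w'. norm (y - x) \<le> \<rho> \<and>
      patch R (model_set w') x = patch R (model_set w) z"
proof -
  obtain U where U: "open U" "st z - w \<in> U"
    "\<And>x w'. x \<in> \<Gamma> \<Longrightarrow> st x - w' \<in> U \<Longrightarrow>
      x \<in> model_set w' \<and> patch R (model_set w') x = patch R (model_set w) z"
    using patch_acceptance_domain[OF assms] by blast
  then obtain \<rho> where "\<And>h y. \<exists>\<gamma>\<in>\<Gamma>. st \<gamma> - h \<in> U \<and> norm (y - \<gamma>) \<le> \<rho>"
    using dense_bounded[of U] by blast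
  with U(3) have "\<exists>x\<in>model_set w'. norm (y - x) \<le> \<rho> \<and>
      patch R (model_set w') x = patch R (model_set w) z" for w' y
    by meson
  then show ?thesis by (rule that)
qed

lemma model_set_nonempty: "model_set w \<noteq> {}"
proof -
  obtain \<gamma> where "\<gamma> \<in> \<Gamma>" "st \<gamma> \<in> (\<lambda>h. h - w) -` interior W"
  proof (rule star_dense)
    show "open ((\<lambda>h. h - w) -` interior W)"
      by (intro open_vimage open_interior continuous_intros)
    obtain h where "h \<in> interior W" using interior_W by blast
    then have "h + w \<in> (\<lambda>h. h - w) -` interior W" by simp
    then show "(\<lambda>h. h - w) -` interior W \<noteq> {}" by blast
  qed
  then have "\<gamma> \<in> model_set w" using interior_subset by (auto simp: mem_model_set)
  then show ?thesis by blast
qed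

lemma model_set_unbounded:
  assumes w: "w \<in> NS \<Sigma> W"
  obtains v where "v \<in> model_set w" "norm (v - z) \<ge> r"
proof -
  obtain z' where z': "z' \<in> model_set w" using model_set_nonempty by blast
  obtain \<rho> where \<rho>: "\<And>w' y. \<exists>x\<in>model_set w'. norm (y - x) \<le> \<rho> \<and>
      patch 1 (model_set w') x = patch 1 (model_set w) z'"
    using model_set_repetitive[OF w z'] by blast
  \<comment> \<open>A point of the model set within \<open>\<rho>\<close> of \<open>y + z\<close> is
    still at distance at least \<open>r\<close> from \<open>z\<close>; the maximum with 0 makes the
    prescribed norm admissible.\<close>
  obtain y :: 'e where y: "norm y = max 0 (r + \<rho>)" using vector_choose_size[of "max 0 (r + \<rho>)"] by auto
  obtain v where v: "v \<in> model_set w" "norm (y + z - v) \<le> \<rho>" using \<rho> by blast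
  have "norm y \<le> norm (v - z) + norm (y + z - v)"
    using norm_triangle_ineq[of "v - z" "y + z - v"] by simp
  then have "norm (v - z) \<ge> r" using v(2) y by linarith
  with v(1) show ?thesis by (rule that)
qed

section \<open>Recognising hull elements by their patches\<close>

lemma language_NS_eq:
  "language_NS \<Sigma> W = {patch R (model_set w) z | w z R. w \<in> NS \<Sigma> W \<and> z \<in> model_set w \<and> R > 0}"
proof -
  have "language_NS \<Sigma> W = (\<Union>w\<in>NS \<Sigma> W. language (model_set w))"
    unfolding language_NS_def nonsingular_model_sets_def model_set_def
    using language_unshift by fastforce
  then show ?thesis unfolding language_eq by blast
qed

text \<open>Patches are compared at equal radii. Inclusion of languages does not give this
  immediately, because a patch as a set does not determine its radius.\<close>

definition locally_nonsingular :: "'e set \<Rightarrow> bool" where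
  "locally_nonsingular \<Lambda> \<longleftrightarrow> (\<forall>x\<in>\<Lambda>. \<forall>R>0. \<exists>w\<in>NS \<Sigma> W. \<exists>z\<in>model_set w.
     patch R \<Lambda> x = patch R (model_set w) z)"

text \<open>Repetitivity is read off from one large patch: around some point of \<Lambda> it looks
  like a nonsingular model set, in which the required pattern occurs near the point corresponding to
  \<open>y\<close>. The bound is the one for model sets, so it does not depend on \<Lambda>.\<close>

lemma locally_nonsingular_repetitive:
  assumes "w \<in> NS \<Sigma> W" "z \<in> model_set w" "R > 0"
  obtains \<rho> where "\<And>\<Lambda> y. \<Lambda> \<noteq> {} \<Longrightarrow> locally_nonsingular \<Lambda> \<Longrightarrow>
    \<exists>x\<in>\<Lambda>. norm (y - x) \<le> \<rho> \<and> patch R \<Lambda> x = patch R (model_set w) z"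
proof -
  obtain \<rho> where \<rho>: "\<And>w' y. \<exists>x\<in>model_set w'. norm (y - x) \<le> \<rho> \<and>
      patch R (model_set w') x = patch R (model_set w) z"
    using model_set_repetitive[OF assms(1,2)] by blast
  show ?thesis
  proof (rule that)
    fix \<Lambda> :: "'e set" and y
    assume "\<Lambda> \<noteq> {}" and ns: "locally_nonsingular \<Lambda>"
    then obtain x0 where x0: "x0 \<in> \<Lambda>" by blast
    have "0 \<le> \<rho>" using \<rho>[of w 0] norm_ge_zero order_trans by blast
    \<comment> \<open>Large enough to go from \<open>x0\<close> to \<open>y\<close>, to move on by
      \<open>\<rho>\<close> to the pattern, and to see its whole \<open>R\<close>-patch.\<close>
    define S where "S = norm (y - x0) + \<rho> + R"
    have "S > 0" using \<open>0 \<le> \<rho>\<close> assms(3) by (simp add: S_def add_nonneg_pos)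
    then obtain w' z' where z': "patch S \<Lambda> x0 = patch S (model_set w') z'"
      using ns x0 unfolding locally_nonsingular_def by blast
    have iff: "x0 + u \<in> \<Lambda> \<longleftrightarrow> z' + u \<in> model_set w'" if "norm u < S" for u
      using that z' mem_patch by blast
    obtain x' where x': "x' \<in> model_set w'" "norm (z' + (y - x0) - x') \<le> \<rho>"
        "patch R (model_set w') x' = patch R (model_set w) z"
      using \<rho> by blast
    define v where "v = x' - z'"
    have v1: "norm ((y - x0) - v) \<le> \<rho>" using x'(2) by (simp add: v_def algebra_simps)
    then have v2: "norm v \<le> norm (y - x0) + \<rho>" using norm_triangle_sub[of v "y - x0"]
      by (simp add: norm_minus_commute)
    have "x0 + v \<in> \<Lambda>" using iff[of v] v2 x'(1) assms(3) by (simp add: v_def S_def)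
    moreover have "norm (y - (x0 + v)) \<le> \<rho>" using v1 by (simp add: algebra_simps)
    moreover have "patch R \<Lambda> (x0 + v) = patch R (model_set w') x'"
    proof -
      have "x0 + v + u \<in> \<Lambda> \<longleftrightarrow> x' + u \<in> model_set w'" if "norm u < R" for u
      proof -
        have "norm (v + u) < S" using v2 that norm_triangle_ineq[of v u] by (simp add: S_def)
        from iff[OF this] show ?thesis by (simp add: v_def add.assoc)
      qed
      then show ?thesis by (auto simp: mem_patch)
    qed
    ultimately show "\<exists>x\<in>\<Lambda>. norm (y - x) \<le> \<rho> \<and> patch R \<Lambda> x = patch R (model_set w) z"
      using x'(3) by metis
  qed
qed

text \<open>From right to left, repetitivity supplies the patches that the language of \<Lambda>
  must contain. From left to right, equal patches come with unrelated radii; a point of \<Lambda> at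
  distance at least \<open>R\<close> from x, visible in both patches, forces both radii above
  \<open>R\<close>, after which both are cut down to \<open>R\<close>.\<close>

lemma hull_iff: "\<Lambda> \<in> \<X> \<longleftrightarrow> \<Lambda> \<noteq> {} \<and> locally_nonsingular \<Lambda>"
proof
  assume "\<Lambda> \<in> \<X>"
  then have L: "{patch R \<Lambda> x | x R. x \<in> \<Lambda> \<and> R > 0} =
      {patch R (model_set w) z | w z R. w \<in> NS \<Sigma> W \<and> z \<in> model_set w \<and> R > 0}"
    by (simp add: model_hull_def language_eq language_NS_eq)
  obtain w z where wz: "w \<in> NS \<Sigma> W" "z \<in> model_set w"
    using nonsingular_exists model_set_nonempty by blast
  then have "patch 1 (model_set w) z \<in> {patch R \<Lambda> x | x R. x \<in> \<Lambda> \<and> R > 0}"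
    unfolding L by force
  then have "\<Lambda> \<noteq> {}" by blast
  moreover have "locally_nonsingular \<Lambda>"
    unfolding locally_nonsingular_def
  proof (intro ballI allI impI)
    fix x and R :: real assume x: "x \<in> \<Lambda>" and R: "R > 0"
    have patch_in: "\<exists>w\<in>NS \<Sigma> W. \<exists>z\<in>model_set w. \<exists>S'. patch S \<Lambda> x = patch S' (model_set w) z"
      if "S > 0" for S
    proof -
      have "patch S \<Lambda> x \<in>
          {patch R (model_set w) z | w z R. w \<in> NS \<Sigma> W \<and> z \<in> model_set w \<and> R > 0}"
        unfolding L[symmetric] using x that by blast
      then show ?thesis by blast
    qed
    \<comment> \<open>Otherwise \<Lambda> lies in an open ball of radius \<open>R\<close>. But its
      language contains a patch with two points at least \<open>2 * R\<close> apart, taken from an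
      unbounded model set.\<close>
    have "\<exists>y\<in>\<Lambda>. norm (y - x) \<ge> R"
    proof (rule ccontr)
      assume "\<not> ?thesis"
      then have bdd: "norm (y - x) < R" if "y \<in> \<Lambda>" for y using that by force
      obtain v where v: "v \<in> model_set w" "norm (v - z) \<ge> 2 * R"
        using model_set_unbounded[OF wz(1)] by blast
      define S where "S = norm (v - z) + 1"
      have "patch S (model_set w) z \<in> {patch R \<Lambda> x | x R. x \<in> \<Lambda> \<and> R > 0}"
        unfolding L using wz by (force simp: S_def add_nonneg_pos)
      then obtain x' S' where x': "x' \<in> \<Lambda>" "patch S (model_set w) z = patch S' \<Lambda> x'" by blast
      have "v - z \<in> patch S (model_set w) z" using v(1) by (simp add: mem_patch S_def)
      then have "x' + (v - z) \<in> \<Lambda>" unfolding x' by (simp add: mem_patch)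
      from bdd[OF this] bdd[OF x'(1)] v(2) show False
        using norm_triangle_ineq4[of "x' + (v - z) - x" "x' - x"] by simp
    qed
    then obtain y where y: "y \<in> \<Lambda>" "norm (y - x) \<ge> R" by blast
    define S where "S = norm (y - x) + 1"
    have "S > 0" by (simp add: S_def add_nonneg_pos)
    then obtain w z S' where *: "w \<in> NS \<Sigma> W" "z \<in> model_set w"
        "patch S \<Lambda> x = patch S' (model_set w) z"
      using patch_in by blast
    have "y - x \<in> patch S \<Lambda> x" using y(1) by (simp add: mem_patch S_def)
    \<comment> \<open>\<open>y - x\<close> occurs in the patch of radius \<open>S'\<close> too, so
      \<open>S'\<close> exceeds its norm.\<close>
    then have "R < S'" using y(2) unfolding *(3) by (simp add: mem_patch)
    moreover have "R < S" using y(2) by (simp add: S_def)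
    ultimately have "u \<in> patch R \<Lambda> x \<longleftrightarrow> u \<in> patch R (model_set w) z" for u
      using *(3) unfolding set_eq_iff mem_patch by (meson less_trans)
    then have "patch R \<Lambda> x = patch R (model_set w) z" by blast
    with * show "\<exists>w\<in>NS \<Sigma> W. \<exists>z\<in>model_set w. patch R \<Lambda> x = patch R (model_set w) z" by blast
  qed
  ultimately show "\<Lambda> \<noteq> {} \<and> locally_nonsingular \<Lambda>" ..
next
  assume *: "\<Lambda> \<noteq> {} \<and> locally_nonsingular \<Lambda>"
  have "{patch R \<Lambda> x | x R. x \<in> \<Lambda> \<and> R > 0} =
      {patch R (model_set w) z | w z R. w \<in> NS \<Sigma> W \<and> z \<in> model_set w \<and> R > 0}" (is "?L = ?R")
  proof
    show "?L \<subseteq> ?R" using * unfolding locally_nonsingular_def by blast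
    show "?R \<subseteq> ?L"
    proof
      fix p assume "p \<in> ?R"
      then obtain w z R where p: "p = patch R (model_set w) z" "w \<in> NS \<Sigma> W" "z \<in> model_set w"
          "R > 0" by blast
      obtain x where "x \<in> \<Lambda>" "patch R \<Lambda> x = patch R (model_set w) z"
        using locally_nonsingular_repetitive[OF p(2-4)] * by metis
      then show "p \<in> ?L" using p by blast
    qed
  qed
  then show "\<Lambda> \<in> \<X>" by (simp add: model_hull_def language_eq language_NS_eq)
qed

section \<open>Uniform geometry of hull elements\<close>

lemma model_set_in_internal_system: "w \<in> NS \<Sigma> W \<Longrightarrow> model_set w \<in> \<Xi>"
  using model_set_nonempty[of w] unfolding internal_system_def hull_iff locally_nonsingular_def
  by (auto simp: mem_model_set \<Gamma>_def)

lemma hull_nonempty: "\<Lambda> \<in> \<X> \<Longrightarrow> \<Lambda> \<noteq> {}"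
  by (simp add: hull_iff)

text \<open>Any single nonsingular patch recurs in all hull elements with the same gaps. The common
  radius is what keeps the empty set from being a limit of patterns.\<close>

lemma hull_relatively_dense:
  obtains \<rho> where "\<And>\<Lambda> y. \<Lambda> \<in> \<X> \<Longrightarrow> \<exists>x\<in>\<Lambda>. norm (y - x) \<le> \<rho>"
proof -
  obtain w z where *: "w \<in> NS \<Sigma> W" "z \<in> model_set w"
    using nonsingular_exists model_set_nonempty by blast
  obtain \<rho> where "\<And>\<Lambda> y. \<Lambda> \<noteq> {} \<Longrightarrow> locally_nonsingular \<Lambda> \<Longrightarrow>
    \<exists>x\<in>\<Lambda>. norm (y - x) \<le> \<rho> \<and> patch 1 \<Lambda> x = patch 1 (model_set w) z"
    using locally_nonsingular_repetitive[OF *, of 1] by auto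
  then have "\<exists>x\<in>\<Lambda>. norm (y - x) \<le> \<rho>" if "\<Lambda> \<in> \<X>" for \<Lambda> y
    using that unfolding hull_iff by meson
  then show ?thesis by (rule that)
qed

text \<open>Two points of \<Lambda> lie in a common patch, which also occurs in a nonsingular model
  set; in the difference of the two stars its parameter w cancels.\<close>

lemma hull_diff:
  assumes "\<Lambda> \<in> \<X>" "x \<in> \<Lambda>" "y \<in> \<Lambda>"
  shows "y - x \<in> P W_diff"
proof -
  define R where "R = norm (y - x) + 1"
  have "R > 0" by (simp add: R_def add_nonneg_pos)
  then obtain w z where *: "z \<in> model_set w" "patch R \<Lambda> x = patch R (model_set w) z"
    using assms unfolding hull_iff locally_nonsingular_def by blast
  have "y - x \<in> patch R \<Lambda> x" using assms by (simp add: mem_patch R_def)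
  then have y: "z + (y - x) \<in> model_set w" using * by (simp add: mem_patch)
  have eq: "y - x = (z + (y - x)) - z" by simp
  have z\<Gamma>: "z \<in> \<Gamma>" "z + (y - x) \<in> \<Gamma>" using * y by (auto simp: mem_model_set)
  have "st (y - x) = st (z + (y - x)) - st z" by (subst eq) (rule star_diff[OF z\<Gamma>(2,1)])
  then have "st (y - x) = (st (z + (y - x)) - w) - (st z - w)" by simp
  then have "st (y - x) \<in> W_diff"
    using *(1) y unfolding mem_model_set by (blast intro: W_diffI)
  moreover have "y - x \<in> \<Gamma>" using diff_in[OF z\<Gamma>(2,1)] by simp
  ultimately show ?thesis by (simp add: mem_proj)
qed

lemma hull_locally_finite:
  assumes "\<Lambda> \<in> \<X>"
  shows "finite (\<Lambda> \<inter> cball x r)"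
proof -
  obtain x0 where x0: "x0 \<in> \<Lambda>" using hull_nonempty[OF assms] by blast
  have "(\<lambda>y. y - x0) ` (\<Lambda> \<inter> cball x r) \<subseteq> {\<gamma> \<in> P W_diff. norm \<gamma> \<le> r + norm (x - x0)}"
  proof (rule image_subsetI)
    fix y assume y: "y \<in> \<Lambda> \<inter> cball x r"
    have "norm (y - x0) \<le> norm (y - x) + norm (x - x0)"
      using norm_triangle_ineq[of "y - x" "x - x0"] by simp
    then show "y - x0 \<in> {\<gamma> \<in> P W_diff. norm \<gamma> \<le> r + norm (x - x0)}"
      using y hull_diff[OF assms x0, of y] by (auto simp: dist_norm norm_minus_commute)
  qed
  then have "finite ((\<lambda>y. y - x0) ` (\<Lambda> \<inter> cball x r))"
    using locally_finite[OF compact_W_diff] finite_subset by blast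
  then show ?thesis by (rule finite_imageD) (simp add: inj_on_def)
qed

lemma hull_unshift: "\<Lambda> \<in> \<X> \<Longrightarrow> unshift t \<Lambda> \<in> \<X>"
  by (simp add: model_hull_def language_unshift)

lemma internal_in_hull: "\<Lambda> \<in> \<Xi> \<Longrightarrow> \<Lambda> \<in> \<X>"
  and internal_subset: "\<Lambda> \<in> \<Xi> \<Longrightarrow> \<Lambda> \<subseteq> \<Gamma>"
  and internalI: "\<Lambda> \<in> \<X> \<Longrightarrow> \<Lambda> \<subseteq> \<Gamma> \<Longrightarrow> \<Lambda> \<in> \<Xi>"
  by (auto simp: internal_system_def \<Gamma>_def)

text \<open>Moving any point of the pattern to the origin turns all its points into differences,
  which belong to \<open>\<Gamma>\<close> by \<open>hull_diff\<close>.\<close>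

lemma hull_decompose:
  assumes "\<Lambda>\<^sub>0 \<in> \<X>"
  obtains \<Lambda> t where "\<Lambda> \<in> \<Xi>" "\<Lambda>\<^sub>0 = unshift t \<Lambda>"
proof -
  obtain x where x: "x \<in> \<Lambda>\<^sub>0" using hull_nonempty[OF assms] by blast
  have "unshift x \<Lambda>\<^sub>0 \<in> \<Xi>"
    using hull_diff[OF assms x] by (intro internalI hull_unshift assms) (auto simp: mem_proj)
  moreover have "\<Lambda>\<^sub>0 = unshift (- x) (unshift x \<Lambda>\<^sub>0)" unfolding unshift_unshift by simp
  ultimately show ?thesis by (rule that)
qed

end

section \<open>Topologies of the hull and of the internal system\<close>

text \<open>Tychonoff's theorem for the Cantor cube \<open>2\<^sup>I\<close>, with neighbourhoods written as finite cylinders.\<close>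

lemma compactin_finite_cylinders:
  fixes X :: "'a set topology"
  assumes sub: "\<A> \<subseteq> topspace X" "\<A> \<subseteq> Pow I"
    and closed: "\<And>\<Lambda>. \<Lambda> \<subseteq> I \<Longrightarrow> \<Lambda> \<notin> \<A> \<Longrightarrow> \<exists>F. finite F \<and> (\<forall>\<Lambda>'\<in>\<A>. \<Lambda>' \<inter> F \<noteq> \<Lambda> \<inter> F)"
    and coarser: "\<And>U \<Lambda>. openin X U \<Longrightarrow> \<Lambda> \<in> U \<Longrightarrow> \<Lambda> \<in> \<A> \<Longrightarrow>
      \<exists>F. finite F \<and> (\<forall>\<Lambda>'\<in>\<A>. \<Lambda>' \<inter> F = \<Lambda> \<inter> F \<longrightarrow> \<Lambda>' \<in> U)"
  shows "compactin X \<A>"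
proof -
  define Q where "Q = product_topology (\<lambda>_. discrete_topology (UNIV :: bool set)) I"
  define h where "h = (\<lambda>f. {x \<in> I. f x})"
  define A where "A = {f \<in> topspace Q. h f \<in> \<A>}"
  \<comment> \<open>Basic open sets of the cube: the coordinates in \<open>F\<close> are prescribed
    by \<open>f\<close>, the others are free. Under \<open>h\<close>, which turns a characteristic
    function into a set, they become the finite cylinders of the hypotheses.\<close>
  define cyl where "cyl = (\<lambda>F f. (\<Pi>\<^sub>E x\<in>I. if x \<in> F then {f x} else (UNIV :: bool set)))"
  have topQ: "topspace Q = (\<Pi>\<^sub>E x\<in>I. UNIV)" by (simp add: Q_def)
  have open_cyl: "openin Q (cyl F f)" if "finite F" for F f
    unfolding Q_def cyl_def openin_PiE_gen using that
    by (intro disjI2 conjI) (auto intro: finite_subset[of _ F])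
  have in_cyl: "f \<in> cyl F f" if "f \<in> topspace Q" for F f
    using that by (auto simp: cyl_def topQ PiE_iff)
  have cyl_sub: "cyl F f \<subseteq> topspace Q" for F f
    by (auto simp: cyl_def topQ PiE_iff)
  have cyl_eq: "h f' \<inter> F = h f \<inter> F" if "f' \<in> cyl F f" for f f' F
  proof -
    have "f' x = f x" if "x \<in> I" "x \<in> F" for x
      using \<open>f' \<in> cyl F f\<close> that by (auto simp: cyl_def PiE_iff split: if_splits)
    then show ?thesis by (auto simp: h_def)
  qed
  have "openin Q (topspace Q - A)"
  proof (subst openin_subopen, rule ballI)
    fix f assume f: "f \<in> topspace Q - A"
    then have "h f \<subseteq> I" "h f \<notin> \<A>" by (auto simp: A_def h_def)
    from closed[OF this] obtain F
      where F: "finite F" "\<forall>\<Lambda>'\<in>\<A>. \<Lambda>' \<inter> F \<noteq> h f \<inter> F" by (elim exE conjE)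
    have "g \<in> topspace Q - A" if "g \<in> cyl F f" for g
      using that F(2) cyl_sub[of F f] cyl_eq[of g F f] unfolding A_def by blast
    then have "cyl F f \<subseteq> topspace Q - A" by blast
    then show "\<exists>T. openin Q T \<and> f \<in> T \<and> T \<subseteq> topspace Q - A"
      using open_cyl[OF F(1), of f] in_cyl[of f F] f by (intro exI[of _ "cyl F f"]) simp
  qed
  then have "closedin Q A" by (simp add: closedin_def A_def)
  moreover have "compact_space Q"
    by (simp add: Q_def compact_space_product_topology compact_space_discrete_topology)
  ultimately have "compactin Q A" using closedin_compact_space by blast
  then have "compactin (subtopology Q A) A" by (simp add: compactin_subtopology)
  \<comment> \<open>The hypothesis \<open>coarser\<close> says that every open set of
    \<open>X\<close> contains a cylinder around each of its members in \<open>\<A>\<close>. This is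
    continuity of \<open>h\<close>, which carries compactness over from the cube.\<close>
  moreover have "continuous_map (subtopology Q A) X h"
    unfolding continuous_map
  proof (intro conjI allI impI)
    show "h ` topspace (subtopology Q A) \<subseteq> topspace X" using sub by (auto simp: A_def)
    fix U assume U: "openin X U"
    show "openin (subtopology Q A) {f \<in> topspace (subtopology Q A). h f \<in> U}"
    proof (subst openin_subopen, rule ballI)
      fix f assume "f \<in> {f \<in> topspace (subtopology Q A). h f \<in> U}"
      then have f: "f \<in> topspace Q" "f \<in> A" "h f \<in> U" "h f \<in> \<A>" by (auto simp: A_def)
      from coarser[OF U f(3,4)]
      obtain F where F: "finite F" "\<forall>\<Lambda>'\<in>\<A>. \<Lambda>' \<inter> F = h f \<inter> F \<longrightarrow> \<Lambda>' \<in> U"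
        by (elim exE conjE)
      have "h g \<in> U" if "g \<in> A" "g \<in> cyl F f" for g
        using F(2) cyl_eq[OF that(2)] that(1) by (simp add: A_def)
      then have "A \<inter> cyl F f \<subseteq> {f \<in> topspace (subtopology Q A). h f \<in> U}"
        by (auto simp: A_def)
      moreover have "openin (subtopology Q A) (A \<inter> cyl F f)"
        using open_cyl[OF F(1)] by (rule openin_subtopology_Int2)
      ultimately show "\<exists>T. openin (subtopology Q A) T \<and> f \<in> T \<and>
          T \<subseteq> {f \<in> topspace (subtopology Q A). h f \<in> U}"
        using f(2) in_cyl[OF f(1)] by (intro exI[of _ "A \<inter> cyl F f"]) simp
    qed
  qed
  ultimately have "compactin X (h ` A)" by (rule image_compactin)
  moreover have "h ` A = \<A>"
  proof
    show "\<A> \<subseteq> h ` A"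
    proof
      fix \<Lambda> assume \<Lambda>: "\<Lambda> \<in> \<A>"
      then have "\<Lambda> \<subseteq> I" using sub(2) by blast
      then have eq: "h (\<lambda>x\<in>I. x \<in> \<Lambda>) = \<Lambda>" by (auto simp: h_def)
      moreover have "(\<lambda>x\<in>I. x \<in> \<Lambda>) \<in> A" using \<Lambda> by (simp add: A_def topQ eq)
      ultimately show "\<Lambda> \<in> h ` A" by (metis imageI)
    qed
  qed (auto simp: A_def)
  ultimately show ?thesis by simp
qed

context cut_and_project
begin

abbreviation "\<X>top \<equiv> hull_topology \<Sigma> W"
abbreviation "\<Xi>top \<equiv> internal_topology \<Sigma> W"

section \<open>Separation, continuity of translation, and compact sets of patterns\<close>

lemma topspace_hull [simp]: "topspace \<X>top = \<X>"
proof (rule antisym)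
  show "topspace \<X>top \<subseteq> \<X>" using openin_topspace openin_hull_topology by blast
  have "openin \<X>top \<X>" unfolding openin_hull_topology
    by (intro conjI ballI exI[of _ "{}"] exI[of _ "1 :: real"]) auto
  then show "\<X> \<subseteq> topspace \<X>top" by (rule openin_subset)
qed

lemma topspace_internal [simp]: "topspace \<Xi>top = \<Xi>"
proof (rule antisym)
  show "topspace \<Xi>top \<subseteq> \<Xi>" using openin_topspace openin_internal_topology by blast
  have "openin \<Xi>top \<Xi>" unfolding openin_internal_topology
    by (intro conjI ballI exI[of _ "{}"]) auto
  then show "\<Xi> \<subseteq> topspace \<Xi>top" by (rule openin_subset)
qed

text \<open>The two values of \<open>b\<close> make membership of a point a clopen condition. These
  sets separate patterns and carry identities to pointwise limits in
  \<open>ellis_equivariant\<close>.\<close>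

lemma openin_internal_member: "openin \<Xi>top {\<Lambda> \<in> \<Xi>. x \<in> \<Lambda> \<longleftrightarrow> b}"
  unfolding openin_internal_topology by (intro conjI ballI exI[of _ "{x}"]) auto

lemma openin_internal_agree: "compact K \<Longrightarrow> openin \<Xi>top {\<Lambda>' \<in> \<Xi>. \<Lambda> \<inter> K = \<Lambda>' \<inter> K}"
  unfolding openin_internal_topology by (intro conjI ballI exI[of _ K]) auto

lemma Hausdorff_internal: "Hausdorff_space \<Xi>top"
  unfolding Hausdorff_space_def topspace_internal
proof (intro allI impI, elim conjE)
  fix \<Lambda> \<Lambda>' assume *: "\<Lambda> \<in> \<Xi>" "\<Lambda>' \<in> \<Xi>" "\<Lambda> \<noteq> \<Lambda>'"
  then obtain x where "(x \<in> \<Lambda>) \<noteq> (x \<in> \<Lambda>')" by blast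
  with * show "\<exists>U V. openin \<Xi>top U \<and> openin \<Xi>top V \<and> \<Lambda> \<in> U \<and> \<Lambda>' \<in> V \<and> disjnt U V"
    by (intro exI[of _ "{A \<in> \<Xi>. x \<in> A \<longleftrightarrow> x \<in> \<Lambda>}"] exI[of _ "{A \<in> \<Xi>. x \<in> A \<longleftrightarrow> x \<in> \<Lambda>'}"] conjI
        openin_internal_member) (auto simp: disjnt_def)
qed

lemma openin_hull_hit: "openin \<X>top {\<Lambda> \<in> \<X>. \<Lambda> \<inter> ball x r \<noteq> {}}"
  unfolding openin_hull_topology
proof (intro conjI ballI)
  fix \<Lambda> assume "\<Lambda> \<in> {\<Lambda> \<in> \<X>. \<Lambda> \<inter> ball x r \<noteq> {}}"
  then obtain y where y: "y \<in> \<Lambda>" "dist x y < r" by auto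
  \<comment> \<open>Half of the slack: the two displacements \<open>t\<close> and \<open>t'\<close>
    together must keep the point inside the ball.\<close>
  define \<epsilon> where "\<epsilon> = (r - dist x y) / 2"
  have "\<Lambda>' \<inter> ball x r \<noteq> {}" if t: "norm t < \<epsilon>" "norm t' < \<epsilon>"
      and eq: "unshift t \<Lambda> \<inter> cball y \<epsilon> = unshift t' \<Lambda>' \<inter> cball y \<epsilon>" for \<Lambda>' t t'
  proof -
    have "y - t \<in> unshift t \<Lambda> \<inter> cball y \<epsilon>" using y t by (simp add: dist_norm)
    then have "y - t + t' \<in> \<Lambda>'" unfolding eq by (simp add: mem_unshift)
    moreover have "norm (x - (y - t + t')) \<le> norm (x - y) + norm t + norm t'"
      using norm_triangle_ineq[of "x - y" t] norm_triangle_ineq4[of "x - y + t" t']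
      by (simp add: algebra_simps)
    then have "y - t + t' \<in> ball x r" using t by (simp add: \<epsilon>_def dist_norm field_simps)
    ultimately show ?thesis by blast
  qed
  moreover have "\<epsilon> > 0" using y by (simp add: \<epsilon>_def)
  ultimately show "\<exists>K \<epsilon>. compact K \<and> \<epsilon> > 0 \<and> {\<Lambda>' \<in> \<X>. \<exists>t t'. norm t < \<epsilon> \<and> norm t' < \<epsilon> \<and>
      unshift t \<Lambda> \<inter> K = unshift t' \<Lambda>' \<inter> K} \<subseteq> {\<Lambda> \<in> \<X>. \<Lambda> \<inter> ball x r \<noteq> {}}"
    by (intro exI[of _ "cball y \<epsilon>"] exI[of _ \<epsilon>] conjI) auto
qed auto

lemma openin_hull_miss: "openin \<X>top {\<Lambda> \<in> \<X>. \<Lambda> \<inter> cball x r = {}}"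
  unfolding openin_hull_topology
proof (intro conjI ballI)
  fix \<Lambda> assume \<Lambda>: "\<Lambda> \<in> {\<Lambda> \<in> \<X>. \<Lambda> \<inter> cball x r = {}}"
  define D where "D = (\<lambda>y. dist x y - r) ` (\<Lambda> \<inter> cball x (r + 1))"
  \<comment> \<open>By local finiteness \<Lambda> stays at distance at least
    \<open>3 * \<epsilon>\<close> from the closed ball; the inserted 1 accounts for points beyond
    radius \<open>r + 1\<close> and for empty \<open>D\<close>. Two thirds absorb \<open>t\<close>
    and \<open>t'\<close>, and the last third gives the strict contradiction.\<close>
  define \<epsilon> where "\<epsilon> = Min (insert 1 D) / 3"
  have D: "finite D" "\<And>d. d \<in> D \<Longrightarrow> d > 0"
    using \<Lambda> hull_locally_finite[of \<Lambda>] by (auto simp: D_def)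
  then have pos: "\<epsilon> > 0" by (simp add: \<epsilon>_def)
  have le1: "3 * \<epsilon> \<le> 1" using D(1) by (simp add: \<epsilon>_def)
  have far: "dist x y \<ge> r + 3 * \<epsilon>" if "y \<in> \<Lambda>" for y
  proof (cases "y \<in> cball x (r + 1)")
    case True
    then have "dist x y - r \<in> D" using that by (simp add: D_def)
    then have "3 * \<epsilon> \<le> dist x y - r" using D(1) by (simp add: \<epsilon>_def)
    then show ?thesis by simp
  next
    case False
    then show ?thesis using le1 by simp
  qed
  have "\<Lambda>' \<inter> cball x r = {}" if t: "norm t < \<epsilon>" "norm t' < \<epsilon>"
      and eq: "unshift t \<Lambda> \<inter> cball x (r + \<epsilon>) = unshift t' \<Lambda>' \<inter> cball x (r + \<epsilon>)" for \<Lambda>' t t'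
  proof (rule ccontr)
    assume "\<Lambda>' \<inter> cball x r \<noteq> {}"
    then obtain y where y: "y \<in> \<Lambda>'" "norm (x - y) \<le> r" by (auto simp: dist_norm)
    have "norm (x - (y - t')) \<le> norm (x - y) + norm t'"
      using norm_triangle_ineq[of "x - y" t'] by (simp add: algebra_simps)
    then have "y - t' \<in> unshift t' \<Lambda>' \<inter> cball x (r + \<epsilon>)"
      using y t by (simp add: dist_norm)
    then have "y - t' + t \<in> \<Lambda>" unfolding eq[symmetric] by (simp add: mem_unshift)
    then have "norm (x - (y - t' + t)) \<ge> r + 3 * \<epsilon>" using far by (simp add: dist_norm)
    moreover have "norm (x - (y - t' + t)) \<le> norm (x - y) + norm t' + norm t"
      using norm_triangle_ineq[of "x - y" t'] norm_triangle_ineq4[of "x - y + t'" t]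
      by (simp add: algebra_simps)
    ultimately show False using y t pos by linarith
  qed
  then show "\<exists>K \<epsilon>. compact K \<and> \<epsilon> > 0 \<and> {\<Lambda>' \<in> \<X>. \<exists>t t'. norm t < \<epsilon> \<and> norm t' < \<epsilon> \<and>
      unshift t \<Lambda> \<inter> K = unshift t' \<Lambda>' \<inter> K} \<subseteq> {\<Lambda> \<in> \<X>. \<Lambda> \<inter> cball x r = {}}"
    using pos by (intro exI[of _ "cball x (r + \<epsilon>)"] exI[of _ \<epsilon>] conjI) auto
qed auto

text \<open>If x belongs to only one of two patterns, local finiteness provides a small closed ball
  around x that the other misses. Hitting the open ball and missing the closed one are disjoint open
  conditions.\<close>

lemma Hausdorff_hull: "Hausdorff_space \<X>top"
  unfolding Hausdorff_space_def topspace_hull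
proof (intro allI impI, elim conjE)
  have sep: "\<exists>U V. openin \<X>top U \<and> openin \<X>top V \<and> \<Lambda> \<in> U \<and> \<Lambda>' \<in> V \<and> disjnt U V"
    if *: "\<Lambda> \<in> \<X>" "\<Lambda>' \<in> \<X>" "x \<in> \<Lambda>" "x \<notin> \<Lambda>'" for \<Lambda> \<Lambda>' x
  proof -
    have "finite (\<Lambda>' \<inter> cball x 1)" by (rule hull_locally_finite[OF *(2)])
    then obtain d where d: "d > 0" "\<And>y. y \<in> \<Lambda>' \<inter> cball x 1 \<Longrightarrow> y \<noteq> x \<Longrightarrow> d \<le> dist x y"
      using finite_set_avoid by metis
    \<comment> \<open>At most 1, to stay where \<open>d\<close> applies, and below \<open>d\<close>,
      so that only \<open>x\<close> itself could lie in the closed ball.\<close>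
    define r where "r = min d 1 / 2"
    have r: "r > 0" "r < d" "r \<le> 1" using d(1) by (auto simp: r_def min_def)
    have "y \<notin> cball x r" if "y \<in> \<Lambda>'" for y
      using that d(2)[of y] *(4) r by fastforce
    then have "\<Lambda>' \<inter> cball x r = {}" by blast
    moreover have "\<Lambda> \<inter> ball x r \<noteq> {}" using *(3) r(1) by auto
    moreover have "disjnt {\<Lambda> \<in> \<X>. \<Lambda> \<inter> ball x r \<noteq> {}} {\<Lambda> \<in> \<X>. \<Lambda> \<inter> cball x r = {}}"
      using ball_subset_cball[of x r] by (auto simp: disjnt_def)
    ultimately show ?thesis using *(1,2) openin_hull_hit[of x r] openin_hull_miss[of x r] by blast
  qed
  fix \<Lambda> \<Lambda>' assume *: "\<Lambda> \<in> \<X>" "\<Lambda>' \<in> \<X>" "\<Lambda> \<noteq> \<Lambda>'"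
  then obtain x where "x \<in> \<Lambda> \<and> x \<notin> \<Lambda>' \<or> x \<in> \<Lambda>' \<and> x \<notin> \<Lambda>" by blast
  then show "\<exists>U V. openin \<X>top U \<and> openin \<X>top V \<and> \<Lambda> \<in> U \<and> \<Lambda>' \<in> V \<and> disjnt U V"
    using sep[OF *(1,2)] sep[OF *(2,1)] by (meson disjnt_sym)
qed

text \<open>A change of the translation vector from \<open>t\<close> to \<open>t'\<close> is
  absorbed by the small displacement \<open>t - t'\<close> that hull neighbourhoods allow; the
  compact set on which patterns must agree is moved along by \<open>t\<close>.\<close>

lemma continuous_unshift:
  "continuous_map (prod_topology \<Xi>top euclidean) \<X>top (\<lambda>p. unshift (snd p) (fst p))"
  unfolding continuous_map
proof (intro conjI allI impI)
  show "(\<lambda>p. unshift (snd p) (fst p)) ` topspace (prod_topology \<Xi>top euclidean) \<subseteq> topspace \<X>top"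
    using hull_unshift internal_in_hull by auto
  fix U assume U: "openin \<X>top U"
  let ?V = "{p \<in> topspace (prod_topology \<Xi>top euclidean). unshift (snd p) (fst p) \<in> U}"
  have "\<exists>A B. openin \<Xi>top A \<and> open B \<and> \<Lambda> \<in> A \<and> t \<in> B \<and> A \<times> B \<subseteq> ?V" if "(\<Lambda>, t) \<in> ?V" for \<Lambda> t
  proof -
    have \<Lambda>: "\<Lambda> \<in> \<Xi>" "unshift t \<Lambda> \<in> U" using that by auto
    then obtain K \<epsilon> where K: "compact K" "\<epsilon> > 0" "{\<Lambda>' \<in> \<X>. \<exists>s s'. norm s < \<epsilon> \<and> norm s' < \<epsilon> \<and>
        unshift s (unshift t \<Lambda>) \<inter> K = unshift s' \<Lambda>' \<inter> K} \<subseteq> U"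
      using U unfolding openin_hull_topology by meson
    define K' where "K' = (\<lambda>x. x + t) ` K"
    have K': "compact K'" unfolding K'_def
      by (intro compact_continuous_image continuous_intros K(1))
    let ?A = "{\<Lambda>' \<in> \<Xi>. \<Lambda> \<inter> K' = \<Lambda>' \<inter> K'}"
    have "?A \<times> ball t \<epsilon> \<subseteq> ?V"
    proof
      fix q assume "q \<in> ?A \<times> ball t \<epsilon>"
      then obtain \<Lambda>' t' where q: "q = (\<Lambda>', t')" and \<Lambda>': "\<Lambda>' \<in> \<Xi>" "\<Lambda> \<inter> K' = \<Lambda>' \<inter> K'"
          and t': "dist t t' < \<epsilon>"
        by auto
      have "x + t \<in> \<Lambda> \<longleftrightarrow> x + t \<in> \<Lambda>'" if "x \<in> K" for x
        using \<Lambda>'(2) that unfolding K'_def by blast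
      then have "unshift 0 (unshift t \<Lambda>) \<inter> K = unshift (t - t') (unshift t' \<Lambda>') \<inter> K"
        unfolding unshift_unshift set_eq_iff Int_iff mem_unshift by auto
      moreover have "norm (t - t') < \<epsilon>" "norm (0::'e) < \<epsilon>" using t' K(2) by (auto simp: dist_norm)
      ultimately have "unshift t' \<Lambda>' \<in> U"
        using hull_unshift[OF internal_in_hull[OF \<Lambda>'(1)]] K(3) by blast
      then show "q \<in> ?V" using \<Lambda>'(1) by (simp add: q)
    qed
    then show ?thesis
      using openin_internal_agree[OF K', of \<Lambda>] \<Lambda>(1) K(2)
      by (intro exI[of _ ?A] exI[of _ "ball t \<epsilon>"]) auto
  qed
  then show "openin (prod_topology \<Xi>top euclidean) ?V"
    unfolding openin_prod_topology_alt open_openin[symmetric] by blast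
qed

text \<open>As \<open>P C\<close> is locally finite, agreement on a compact set is agreement on
  finitely many points, so cylinders describe the topology here. A subset of \<open>P C\<close>
  outside \<open>\<Xi>\<close> is either empty or has a bad patch, by \<open>hull_iff\<close>; both
  defects show on a finite set of points.\<close>

lemma compactin_internal_bounded:
  assumes C: "compact C"
  shows "compactin \<Xi>top {\<Lambda> \<in> \<Xi>. \<Lambda> \<subseteq> P C}"
proof (rule compactin_finite_cylinders[where I = "P C"])
  fix \<Lambda> assume sub: "\<Lambda> \<subseteq> P C" and "\<Lambda> \<notin> {\<Lambda> \<in> \<Xi>. \<Lambda> \<subseteq> P C}"
  then have "\<Lambda> \<notin> \<Xi>" by blast
  moreover have "\<Lambda> \<subseteq> \<Gamma>" using sub mem_proj by blast
  ultimately have not_hull: "\<Lambda> \<notin> \<X>" using internalI by blast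
  show "\<exists>F. finite F \<and> (\<forall>\<Lambda>'\<in>{\<Lambda> \<in> \<Xi>. \<Lambda> \<subseteq> P C}. \<Lambda>' \<inter> F \<noteq> \<Lambda> \<inter> F)"
  proof (cases "\<Lambda> = {}")
    case True
    \<comment> \<open>Every pattern of the hull has a point of norm at most \<open>\<rho>\<close>,
      which distinguishes it from the empty set.\<close>
    obtain \<rho> where \<rho>: "\<And>\<Lambda> y. \<Lambda> \<in> \<X> \<Longrightarrow> \<exists>x\<in>\<Lambda>. norm (y - x) \<le> \<rho>"
      using hull_relatively_dense by blast
    let ?F = "{\<gamma> \<in> P C. norm \<gamma> \<le> \<rho>}"
    have "\<Lambda>' \<inter> ?F \<noteq> {}" if "\<Lambda>' \<in> \<Xi>" "\<Lambda>' \<subseteq> P C" for \<Lambda>'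
      using \<rho>[OF internal_in_hull[OF that(1)], of 0] that(2) by auto
    then show ?thesis using True by (intro exI[of _ ?F]) (auto simp: locally_finite[OF C])
  next
    case False
    then obtain x R where x: "x \<in> \<Lambda>" "R > 0"
        "\<not> (\<exists>w\<in>NS \<Sigma> W. \<exists>z\<in>model_set w. patch R \<Lambda> x = patch R (model_set w) z)"
      using not_hull unfolding hull_iff locally_nonsingular_def by blast
    let ?F = "{\<gamma> \<in> P C. norm \<gamma> \<le> norm x + R}"
    have "\<Lambda>' \<inter> ?F \<noteq> \<Lambda> \<inter> ?F" if \<Lambda>': "\<Lambda>' \<in> \<Xi>" "\<Lambda>' \<subseteq> P C" for \<Lambda>'
    proof
      assume eq: "\<Lambda>' \<inter> ?F = \<Lambda> \<inter> ?F"
      have iff: "x + u \<in> \<Lambda>' \<longleftrightarrow> x + u \<in> \<Lambda>" if "norm u < R" for u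
      proof -
        have "norm (x + u) \<le> norm x + R" using that norm_triangle_ineq[of x u] by simp
        then show ?thesis using eq sub \<Lambda>'(2) by blast
      qed
      have "x \<in> \<Lambda>'" using iff[of 0] x by simp
      moreover have "patch R \<Lambda>' x = patch R \<Lambda> x" using iff by (auto simp: mem_patch)
      ultimately show False
        using internal_in_hull[OF \<Lambda>'(1)] x(2,3) unfolding hull_iff locally_nonsingular_def by metis
    qed
    then show ?thesis by (intro exI[of _ ?F]) (auto simp: locally_finite[OF C])
  qed
next
  fix U \<Lambda> assume "openin \<Xi>top U" "\<Lambda> \<in> U"
  then obtain K where K: "compact K" "{\<Lambda>' \<in> \<Xi>. \<Lambda> \<inter> K = \<Lambda>' \<inter> K} \<subseteq> U"
    unfolding openin_internal_topology by blast
  obtain R where R: "\<And>x. x \<in> K \<Longrightarrow> norm x \<le> R"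
    using compact_imp_bounded[OF K(1)] unfolding bounded_iff by blast
  assume \<Lambda>: "\<Lambda> \<in> {\<Lambda> \<in> \<Xi>. \<Lambda> \<subseteq> P C}"
  let ?F = "{\<gamma> \<in> P C. norm \<gamma> \<le> R}"
  have "\<Lambda>' \<in> U" if "\<Lambda>' \<in> \<Xi>" "\<Lambda>' \<subseteq> P C" "\<Lambda>' \<inter> ?F = \<Lambda> \<inter> ?F" for \<Lambda>'
  proof -
    have "\<Lambda> \<inter> K = \<Lambda>' \<inter> K" using R that \<Lambda> by blast
    then show ?thesis using K(2) that(1) by blast
  qed
  then show "\<exists>F. finite F \<and> (\<forall>\<Lambda>'\<in>{\<Lambda> \<in> \<Xi>. \<Lambda> \<subseteq> P C}. \<Lambda>' \<inter> F = \<Lambda> \<inter> F \<longrightarrow> \<Lambda>' \<in> U)"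
    by (intro exI[of _ ?F]) (auto simp: locally_finite[OF C])
qed auto

end

section \<open>Ellis semigroups and the suspension\<close>

context cut_and_project
begin

abbreviation "\<Xi>maps \<equiv> product_topology (\<lambda>_. \<Xi>top) \<Xi>"
abbreviation "\<X>maps \<equiv> product_topology (\<lambda>_. \<X>top) \<X>"
abbreviation "act \<equiv> act_map \<Xi>top shift"
abbreviation "E\<Xi> \<equiv> ellis \<Xi>top shift \<Gamma>"
abbreviation "E\<X> \<equiv> ellis \<X>top unshift UNIV"

section \<open>Equivariant self-maps of the internal system\<close>

lemma internal_shift:
  assumes "\<Lambda> \<in> \<Xi>" "\<gamma> \<in> \<Gamma>"
  shows "shift \<gamma> \<Lambda> \<in> \<Xi>"
proof (rule internalI)
  show "shift \<gamma> \<Lambda> \<in> \<X>"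
    unfolding shift_eq_unshift by (intro hull_unshift internal_in_hull assms(1))
  show "shift \<gamma> \<Lambda> \<subseteq> \<Gamma>"
  proof
    fix x assume "x \<in> shift \<gamma> \<Lambda>"
    then have "x - \<gamma> \<in> \<Gamma>" using internal_subset[OF assms(1)] by (auto simp: mem_shift)
    from add_in[OF this assms(2)] show "x \<in> \<Gamma>" by simp
  qed
qed

lemma act_apply: "\<Lambda> \<in> \<Xi> \<Longrightarrow> act \<gamma> \<Lambda> = shift \<gamma> \<Lambda>"
  by (simp add: act_map_def)

lemma act_in: "\<gamma> \<in> \<Gamma> \<Longrightarrow> act \<gamma> \<in> \<Xi> \<rightarrow>\<^sub>E \<Xi>"
  by (auto simp: act_map_def internal_shift)

lemma shift_shift: "shift s (shift t \<Lambda>) = shift (t + s) \<Lambda>" for \<Lambda> :: "'e set"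
  unfolding set_eq_iff mem_shift by (simp add: algebra_simps)

text \<open>The common property of translations and their limits on which \<open>tilde\<close>
  depends. It is stable under composition, so representatives of classes and their products can be
  computed within this set of maps.\<close>

definition equivariant :: "('e set \<Rightarrow> 'e set) \<Rightarrow> bool" where
  "equivariant g \<longleftrightarrow> g \<in> \<Xi> \<rightarrow>\<^sub>E \<Xi> \<and> (\<forall>\<gamma>\<in>\<Gamma>. \<forall>\<Lambda>\<in>\<Xi>. g (shift \<gamma> \<Lambda>) = shift \<gamma> (g \<Lambda>))"

lemma equivariant_in: "equivariant g \<Longrightarrow> \<Lambda> \<in> \<Xi> \<Longrightarrow> g \<Lambda> \<in> \<Xi>"
  and equivariant_shift: "equivariant g \<Longrightarrow> \<gamma> \<in> \<Gamma> \<Longrightarrow> \<Lambda> \<in> \<Xi> \<Longrightarrow> g (shift \<gamma> \<Lambda>) = shift \<gamma> (g \<Lambda>)"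
  by (auto simp: equivariant_def)

lemma equivariant_act: "\<gamma> \<in> \<Gamma> \<Longrightarrow> equivariant (act \<gamma>)"
  using act_in by (auto simp: equivariant_def act_apply internal_shift shift_shift add.commute)

lemma equivariant_compose:
  "equivariant g \<Longrightarrow> equivariant h \<Longrightarrow> equivariant (compose \<Xi> h g)"
  using equivariant_in[of g] equivariant_in[of h] equivariant_shift[of g] equivariant_shift[of h]
  by (simp add: equivariant_def[of "compose \<Xi> h g"] PiE_iff compose_eq internal_shift)

lemma act_in_ellis:
  assumes "\<gamma> \<in> \<Gamma>"
  shows "act \<gamma> \<in> E\<Xi>"
proof -
  have "act ` \<Gamma> \<subseteq> topspace \<Xi>maps" using act_in by auto
  then have "act ` \<Gamma> \<subseteq> \<Xi>maps closure_of act ` \<Gamma>" by (rule closure_of_subset)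
  then show ?thesis using assms unfolding ellis_def topspace_internal by (rule subsetD[OF _ imageI])
qed

lemma ellis_maps: "g \<in> E\<Xi> \<Longrightarrow> g \<in> \<Xi> \<rightarrow>\<^sub>E \<Xi>"
  using closure_of_subset_topspace[of \<Xi>maps "act ` \<Gamma>"] by (auto simp: ellis_def)

text \<open>For a fixed point x the two memberships to be compared are clopen conditions on g. Hence
  some translation by \<open>\<Gamma>\<close> agrees with g on both, and for a translation they are
  equivalent because \<open>\<Gamma>\<close> is commutative.\<close>

lemma ellis_equivariant:
  assumes "g \<in> E\<Xi>"
  shows "equivariant g"
proof -
  have "g (shift \<gamma> \<Lambda>) = shift \<gamma> (g \<Lambda>)" if "\<gamma> \<in> \<Gamma>" "\<Lambda> \<in> \<Xi>" for \<gamma> \<Lambda>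
  proof (rule Set.set_eqI)
    fix x
    let ?\<Lambda>' = "shift \<gamma> \<Lambda>"
    define V where "V = {h \<in> topspace \<Xi>maps. h ?\<Lambda>' \<in> {A \<in> \<Xi>. x \<in> A \<longleftrightarrow> x \<in> g ?\<Lambda>'}} \<inter>
      {h \<in> topspace \<Xi>maps. h \<Lambda> \<in> {A \<in> \<Xi>. x - \<gamma> \<in> A \<longleftrightarrow> x - \<gamma> \<in> g \<Lambda>}}"
    have \<Lambda>': "?\<Lambda>' \<in> \<Xi>" using that by (rule internal_shift[rotated])
    have "openin \<Xi>maps V"
      unfolding V_def
      by (intro openin_Int openin_continuous_map_preimage[OF continuous_map_product_projection]
          openin_internal_member \<Lambda>' that)
    moreover have "g \<in> V"
      using ellis_maps[OF assms] \<Lambda>' that by (auto simp: V_def PiE_mem)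
    ultimately obtain \<delta> where "\<delta> \<in> \<Gamma>" "act \<delta> \<in> V"
      using assms unfolding ellis_def in_closure_of topspace_internal by (metis imageE)
    then have "x \<in> shift \<delta> ?\<Lambda>' \<longleftrightarrow> x \<in> g ?\<Lambda>'" "x - \<gamma> \<in> shift \<delta> \<Lambda> \<longleftrightarrow> x - \<gamma> \<in> g \<Lambda>"
      using \<Lambda>' that(2) by (auto simp: V_def act_apply)
    moreover have "x \<in> shift \<delta> ?\<Lambda>' \<longleftrightarrow> x - \<gamma> \<in> shift \<delta> \<Lambda>"
      unfolding mem_shift by (simp add: algebra_simps)
    ultimately show "x \<in> g ?\<Lambda>' \<longleftrightarrow> x \<in> shift \<gamma> (g \<Lambda>)" by (simp add: mem_shift)
  qed
  then show ?thesis using ellis_maps[OF assms] by (simp add: equivariant_def)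
qed

text \<open>Both patterns lie in \<open>\<Gamma>\<close> and are nonempty, so a common point seen in
  the two presentations forces \<open>t - s\<close> into \<open>\<Gamma>\<close>. Used for
  \<open>tilde\<close> to be well defined and, in \<open>susp_map_eq_imp\<close>, for the
  fibres.\<close>

lemma unshift_eq_unshift:
  assumes "\<Lambda> \<in> \<Xi>" "\<Lambda>' \<in> \<Xi>" "unshift s \<Lambda> = unshift t \<Lambda>'"
  shows "t - s \<in> \<Gamma>" "\<Lambda>' = shift (t - s) \<Lambda>"
proof -
  have iff: "x \<in> \<Lambda>' \<longleftrightarrow> x - (t - s) \<in> \<Lambda>" for x
  proof -
    have "x - t \<in> unshift s \<Lambda> \<longleftrightarrow> x - t \<in> unshift t \<Lambda>'" by (simp only: assms(3))
    moreover have "x - t + s = x - (t - s)" by simp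
    ultimately show ?thesis unfolding mem_unshift by simp
  qed
  show "\<Lambda>' = shift (t - s) \<Lambda>" by (rule Set.set_eqI) (simp only: mem_shift iff)
  obtain x where x: "x \<in> \<Lambda>'" using hull_nonempty[OF internal_in_hull[OF assms(2)]] by blast
  have "x \<in> \<Gamma>" "x - (t - s) \<in> \<Gamma>"
    by (fact subsetD[OF internal_subset[OF assms(2)] x]
        subsetD[OF internal_subset[OF assms(1)] iff[THEN iffD1, OF x]])+
  from diff_in[OF this] show "t - s \<in> \<Gamma>" by simp
qed

lemma tilde_unshift:
  assumes g: "equivariant g" and \<Lambda>: "\<Lambda> \<in> \<Xi>"
  shows "tilde \<Sigma> W g (unshift t \<Lambda>) = unshift t (g \<Lambda>)"
proof -
  have "unshift t \<Lambda> \<in> \<X>" by (intro hull_unshift internal_in_hull \<Lambda>)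
  moreover have "(THE \<Lambda>\<^sub>1. \<exists>\<Lambda>'\<in>\<Xi>. \<exists>s. unshift t \<Lambda> = unshift s \<Lambda>' \<and> \<Lambda>\<^sub>1 = unshift s (g \<Lambda>')) =
      unshift t (g \<Lambda>)"
  proof (rule the_equality)
    show "\<exists>\<Lambda>'\<in>\<Xi>. \<exists>s. unshift t \<Lambda> = unshift s \<Lambda>' \<and> unshift t (g \<Lambda>) = unshift s (g \<Lambda>')"
      using \<Lambda> by blast
  next
    fix \<Lambda>\<^sub>1 assume "\<exists>\<Lambda>'\<in>\<Xi>. \<exists>s. unshift t \<Lambda> = unshift s \<Lambda>' \<and> \<Lambda>\<^sub>1 = unshift s (g \<Lambda>')"
    then obtain \<Lambda>' s where *: "\<Lambda>' \<in> \<Xi>" "unshift t \<Lambda> = unshift s \<Lambda>'" "\<Lambda>\<^sub>1 = unshift s (g \<Lambda>')"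
      by blast
    have "g \<Lambda>' = shift (s - t) (g \<Lambda>)"
      using unshift_eq_unshift[OF \<Lambda> *(1,2)] equivariant_shift[OF g _ \<Lambda>] by simp
    then show "\<Lambda>\<^sub>1 = unshift t (g \<Lambda>)" unfolding *(3) by (simp only: unshift_shift) simp
  qed
  ultimately show ?thesis by (simp add: tilde_def)
qed

section \<open>The map from pairs to self-maps of the hull\<close>

definition susp_map :: "('e set \<Rightarrow> 'e set) \<times> 'e \<Rightarrow> 'e set \<Rightarrow> 'e set" where
  "susp_map p = (\<lambda>\<Lambda>\<^sub>0\<in>\<X>. unshift (snd p) (tilde \<Sigma> W (fst p) \<Lambda>\<^sub>0))"

lemma susp_map_apply:
  assumes "equivariant g" "\<Lambda> \<in> \<Xi>"
  shows "susp_map (g, t) (unshift s \<Lambda>) = unshift (t + s) (g \<Lambda>)"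
  using assms hull_unshift[OF internal_in_hull[OF assms(2)]]
  by (simp only: susp_map_def restrict_apply' fst_conv snd_conv tilde_unshift unshift_unshift)

lemma susp_map_eqI:
  assumes "f \<in> extensional \<X>"
    and "\<And>\<Lambda> s. \<Lambda> \<in> \<Xi> \<Longrightarrow> susp_map p (unshift s \<Lambda>) = f (unshift s \<Lambda>)"
  shows "susp_map p = f"
proof (rule extensionalityI[OF _ assms(1)])
  show "susp_map p \<in> extensional \<X>" by (simp add: susp_map_def)
  show "susp_map p \<Lambda>\<^sub>0 = f \<Lambda>\<^sub>0" if "\<Lambda>\<^sub>0 \<in> \<X>" for \<Lambda>\<^sub>0
    using hull_decompose[OF that] assms(2) by metis
qed

lemma susp_map_extensional: "susp_map p \<in> extensional \<X>"
  by (simp add: susp_map_def)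

lemma susp_map_in:
  assumes "equivariant g"
  shows "susp_map (g, t) \<in> \<X> \<rightarrow>\<^sub>E \<X>"
proof (rule PiE_I)
  fix \<Lambda>\<^sub>0 assume "\<Lambda>\<^sub>0 \<in> \<X>"
  then obtain \<Lambda> s where *: "\<Lambda> \<in> \<Xi>" "\<Lambda>\<^sub>0 = unshift s \<Lambda>" by (rule hull_decompose)
  show "susp_map (g, t) \<Lambda>\<^sub>0 \<in> \<X>"
    unfolding *(2) susp_map_apply[OF assms *(1)]
    by (rule hull_unshift[OF internal_in_hull[OF equivariant_in[OF assms *(1)]]])
qed (simp add: susp_map_def)

lemma susp_map_compose:
  assumes g: "equivariant g" and h: "equivariant h"
  shows "susp_map (compose \<Xi> h g, t + s) = compose \<X> (susp_map (h, s)) (susp_map (g, t))"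
proof (rule susp_map_eqI)
  show "compose \<X> (susp_map (h, s)) (susp_map (g, t)) \<in> extensional \<X>" by simp
  fix \<Lambda> r assume \<Lambda>: "\<Lambda> \<in> \<Xi>"
  have "susp_map (compose \<Xi> h g, t + s) (unshift r \<Lambda>) = unshift (t + s + r) (h (g \<Lambda>))"
    unfolding susp_map_apply[OF equivariant_compose[OF g h] \<Lambda>] by (simp only: compose_eq \<Lambda>)
  also have "\<dots> = susp_map (h, s) (susp_map (g, t) (unshift r \<Lambda>))"
    unfolding susp_map_apply[OF g \<Lambda>] susp_map_apply[OF h equivariant_in[OF g \<Lambda>]]
    by (simp add: algebra_simps)
  finally show "susp_map (compose \<Xi> h g, t + s) (unshift r \<Lambda>) =
      compose \<X> (susp_map (h, s)) (susp_map (g, t)) (unshift r \<Lambda>)"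
    by (simp only: compose_eq hull_unshift internal_in_hull \<Lambda>)
qed

text \<open>The signs differ because \<open>\<Gamma>\<close> acts by addition and \<real>^d by
  subtraction. This is why the diagonal pairs (\<gamma>, \<gamma>) act as the identity.\<close>

lemma susp_map_act:
  assumes "\<gamma> \<in> \<Gamma>"
  shows "susp_map (act \<gamma>, t) = act_map \<X>top unshift (t - \<gamma>)"
proof (rule susp_map_eqI)
  fix \<Lambda> s assume \<Lambda>: "\<Lambda> \<in> \<Xi>"
  have "susp_map (act \<gamma>, t) (unshift s \<Lambda>) = unshift (t + s - \<gamma>) \<Lambda>"
    unfolding susp_map_apply[OF equivariant_act[OF assms] \<Lambda>] act_apply[OF \<Lambda>] unshift_shift ..
  also have "\<dots> = act_map \<X>top unshift (t - \<gamma>) (unshift s \<Lambda>)"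
    using hull_unshift[OF internal_in_hull[OF \<Lambda>], of s]
    by (simp only: act_map_def topspace_hull restrict_apply' unshift_unshift) (simp add: algebra_simps)
  finally show "susp_map (act \<gamma>, t) (unshift s \<Lambda>) =
      act_map \<X>top unshift (t - \<gamma>) (unshift s \<Lambda>)" .
qed (simp add: act_map_def)

lemma susp_map_diagonal:
  assumes "equivariant g" "\<gamma> \<in> \<Gamma>"
  shows "susp_map (compose \<Xi> (act \<gamma>) g, t + \<gamma>) = susp_map (g, t)"
proof -
  have "act_map \<X>top unshift 0 = restrict id \<X>" by (simp add: act_map_def restrict_def fun_eq_iff)
  then have "susp_map (act \<gamma>, \<gamma>) = restrict id \<X>" by (simp add: susp_map_act[OF assms(2)])
  then have "susp_map (compose \<Xi> (act \<gamma>) g, t + \<gamma>) =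
      compose \<X> (restrict id \<X>) (susp_map (g, t))"
    by (simp add: susp_map_compose[OF assms(1) equivariant_act[OF assms(2)]])
  also have "\<dots> = susp_map (g, t)"
    using susp_map_in[OF assms(1), of t]
    by (intro extensionalityI[where A = \<X>]) (auto simp: compose_def susp_map_extensional PiE_mem)
  finally show ?thesis .
qed

text \<open>Evaluating at patterns of \<open>\<Xi>\<close> gives two presentations of one hull
  element. The resulting vector \<open>s - t\<close> is the same for all of them, so a single
  \<gamma> relates the maps g and h.\<close>

lemma susp_map_eq_imp:
  assumes g: "equivariant g" and h: "equivariant h" and eq: "susp_map (g, t) = susp_map (h, s)"
  obtains \<gamma> where "\<gamma> \<in> \<Gamma>" "h = compose \<Xi> (act \<gamma>) g" "s = t + \<gamma>"
proof -
  have *: "unshift t (g \<Lambda>) = unshift s (h \<Lambda>)" if "\<Lambda> \<in> \<Xi>" for \<Lambda>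
    using susp_map_apply[OF g that, of t 0] susp_map_apply[OF h that, of s 0] eq by simp
  note gh = unshift_eq_unshift[OF equivariant_in[OF g] equivariant_in[OF h] *]
  \<comment> \<open>Some pattern must exist for \<open>s - t\<close> to be recognised as an element
    of \<open>\<Gamma>\<close>.\<close>
  obtain \<Lambda> where "\<Lambda> \<in> \<Xi>" using nonsingular_exists model_set_in_internal_system by blast
  then have "s - t \<in> \<Gamma>" using gh(1) by blast
  moreover have "h = compose \<Xi> (act (s - t)) g"
  proof (rule extensionalityI[where A = \<Xi>])
    show "h \<in> extensional \<Xi>" using h by (auto simp: equivariant_def PiE_def)
    show "h \<Lambda> = compose \<Xi> (act (s - t)) g \<Lambda>" if "\<Lambda> \<in> \<Xi>" for \<Lambda>
      using gh(2)[OF that that that] that by (simp add: compose_eq act_apply equivariant_in[OF g])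
  qed simp
  ultimately show ?thesis using that[of "s - t"] by simp
qed

section \<open>Continuity, and surjectivity onto the Ellis semigroup of the hull\<close>

lemma topspace_ellis: "topspace (ellis_topology \<Xi>top shift \<Gamma>) = E\<Xi>"
  using closure_of_subset_topspace[of \<Xi>maps] by (auto simp: ellis_topology_def ellis_def)

text \<open>At a hull element written as \<open>unshift s \<Lambda>\<close>, the value is the
  translation by \<open>t + s\<close> of \<open>g \<Lambda>\<close>. It depends continuously on (g,
  t) by \<open>continuous_unshift\<close>, since evaluation at \<Lambda> is continuous for pointwise
  convergence.\<close>

lemma continuous_susp_map:
  "continuous_map (prod_topology (ellis_topology \<Xi>top shift \<Gamma>) euclidean) \<X>maps susp_map"
    (is "continuous_map ?Q _ _")
proof -
  have "continuous_map ?Q \<X>top (\<lambda>p. susp_map p \<Lambda>\<^sub>0)" if \<Lambda>\<^sub>0: "\<Lambda>\<^sub>0 \<in> \<X>" for \<Lambda>\<^sub>0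
  proof -
    obtain \<Lambda> s where *: "\<Lambda> \<in> \<Xi>" "\<Lambda>\<^sub>0 = unshift s \<Lambda>" using \<Lambda>\<^sub>0 by (rule hull_decompose)
    have "continuous_map (ellis_topology \<Xi>top shift \<Gamma>) \<Xi>top (\<lambda>g. g \<Lambda>)"
      unfolding ellis_topology_def topspace_internal
      by (intro continuous_map_from_subtopology continuous_map_product_projection *(1))
    then have ev: "continuous_map ?Q \<Xi>top (\<lambda>p. fst p \<Lambda>)"
      by (rule continuous_map_compose[OF continuous_map_fst, unfolded o_def])
    have "continuous_map euclidean euclidean (\<lambda>t. t + s)" by (simp add: continuous_intros)
    then have "continuous_map ?Q euclidean (\<lambda>p. snd p + s)"
      by (rule continuous_map_compose[OF continuous_map_snd, unfolded o_def])
    with ev have "continuous_map ?Q (prod_topology \<Xi>top euclidean) (\<lambda>p. (fst p \<Lambda>, snd p + s))"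
      by (rule continuous_map_pairedI)
    from continuous_map_compose[OF this continuous_unshift]
    have "continuous_map ?Q \<X>top (\<lambda>p. unshift (snd p + s) (fst p \<Lambda>))" by (simp add: o_def)
    moreover have "unshift (snd p + s) (fst p \<Lambda>) = susp_map p \<Lambda>\<^sub>0" if "p \<in> topspace ?Q" for p
    proof -
      have "equivariant (fst p)" using that ellis_equivariant by (auto simp: topspace_ellis)
      from susp_map_apply[OF this *(1), of "snd p" s] show ?thesis by (simp add: *(2))
    qed
    ultimately show ?thesis by (rule continuous_map_eq)
  qed
  then show ?thesis
    unfolding continuous_map_componentwise by (auto simp: susp_map_extensional)
qed

text \<open>Pairs whose first component is a translation are dense, and they are sent to
  translations of the hull; the rest is continuity.\<close>

lemma susp_map_in_ellis:
  assumes "g \<in> E\<Xi>"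
  shows "susp_map (g, t) \<in> E\<X>"
proof -
  let ?E = "ellis_topology \<Xi>top shift \<Gamma>"
  have "?E closure_of (act ` \<Gamma>) = E\<Xi>"
    using act_in_ellis by (simp add: ellis_topology_def closure_of_subtopology Int_absorb1 image_subset_iff)
      (simp add: ellis_def)
  then have "(g, t) \<in> prod_topology ?E euclidean closure_of (act ` \<Gamma> \<times> UNIV)"
    using assms by (simp add: closure_of_Times)
  then have "susp_map (g, t) \<in> \<X>maps closure_of (susp_map ` (act ` \<Gamma> \<times> UNIV))"
    using continuous_map_image_closure_subset[OF continuous_susp_map] by blast
  moreover have "susp_map ` (act ` \<Gamma> \<times> UNIV) \<subseteq> act_map \<X>top unshift ` UNIV"
    using susp_map_act by auto
  ultimately show ?thesis unfolding ellis_def topspace_hull using closure_of_mono by blast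
qed

text \<open>A pattern in \<open>\<Xi>\<close> projects into a translate of \<open>W - W\<close>, so translations by group elements
  whose stars stay in a compact set move it within a compact part of \<open>\<Xi>\<close>, and Tychonoff's
  theorem applies.\<close>

lemma ellis_bounded_compact:
  assumes K: "compact K"
  obtains E where "E \<subseteq> E\<Xi>" "compactin \<Xi>maps E" "\<And>\<gamma>. \<gamma> \<in> \<Gamma> \<Longrightarrow> st \<gamma> \<in> K \<Longrightarrow> act \<gamma> \<in> E"
proof -
  define A where "A = act ` {\<gamma> \<in> \<Gamma>. st \<gamma> \<in> K}"
  have "\<exists>x. x \<in> \<Lambda>" if "\<Lambda> \<in> \<Xi>" for \<Lambda> using hull_nonempty internal_in_hull that by blast
  then obtain pt where pt: "\<And>\<Lambda>. \<Lambda> \<in> \<Xi> \<Longrightarrow> pt \<Lambda> \<in> \<Lambda>" by metis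
  \<comment> \<open>A point of \<open>shift \<gamma> \<Lambda>\<close> has star
    \<open>st \<gamma>\<close>, plus a difference in W - W, plus the star of the base point
    \<open>pt \<Lambda>\<close>; with \<open>st \<gamma>\<close> in \<open>K\<close> this is a
    compact set depending on \<Lambda> alone.\<close>
  define C where "C = (\<lambda>\<Lambda>. (\<lambda>p. fst p + snd p + st (pt \<Lambda>)) ` (K \<times> W_diff))"
  define B where "B = (\<Pi>\<^sub>E \<Lambda>\<in>\<Xi>. {\<Lambda>' \<in> \<Xi>. \<Lambda>' \<subseteq> P (C \<Lambda>)})"
  have C: "compact (C \<Lambda>)" for \<Lambda>
    unfolding C_def
    by (intro compact_continuous_image compact_Times K compact_W_diff continuous_intros)
  then have cB: "compactin \<Xi>maps B"
    unfolding B_def compactin_PiE by (intro disjI2 ballI compactin_internal_bounded)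
  have clB: "closedin \<Xi>maps B"
    using cB Hausdorff_internal by (intro compactin_imp_closedin) (auto simp: Hausdorff_space_product_topology)
  have "A \<subseteq> B"
  proof
    fix a assume "a \<in> A"
    then obtain \<gamma> where \<gamma>: "\<gamma> \<in> \<Gamma>" "st \<gamma> \<in> K" "a = act \<gamma>" unfolding A_def by blast
    have "shift \<gamma> \<Lambda> \<subseteq> P (C \<Lambda>)" if \<Lambda>: "\<Lambda> \<in> \<Xi>" for \<Lambda>
    proof
      fix y assume "y \<in> shift \<gamma> \<Lambda>"
      then have y: "y - \<gamma> \<in> \<Lambda>" by (simp add: mem_shift)
      have \<Gamma>: "pt \<Lambda> \<in> \<Gamma>" "y - \<gamma> \<in> \<Gamma>" using y pt[OF \<Lambda>] internal_subset[OF \<Lambda>] by auto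
      have "y - \<gamma> - pt \<Lambda> \<in> P W_diff" using hull_diff[OF internal_in_hull[OF \<Lambda>] pt[OF \<Lambda>] y] .
      then have d: "st (y - \<gamma>) - st (pt \<Lambda>) \<in> W_diff" using \<Gamma> by (simp add: mem_proj star_diff)
      have "st y = st (\<gamma> + (y - \<gamma>))" by simp
      also have "\<dots> = st \<gamma> + (st (y - \<gamma>) - st (pt \<Lambda>)) + st (pt \<Lambda>)"
        by (subst star_add[OF \<gamma>(1) \<Gamma>(2)]) (simp add: algebra_simps)
      finally have "st y \<in> C \<Lambda>"
        using \<gamma>(2) d unfolding C_def by (intro image_eqI[of _ _ "(st \<gamma>, st (y - \<gamma>) - st (pt \<Lambda>))"]) auto
      moreover have "y \<in> \<Gamma>" using add_in[OF \<gamma>(1) \<Gamma>(2)] by simp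
      ultimately show "y \<in> P (C \<Lambda>)" by (simp add: mem_proj)
    qed
    then show "a \<in> B" unfolding B_def \<gamma>(3) act_map_def topspace_internal
      by (intro restrict_PiE_iff[THEN iffD2] ballI) (auto simp: internal_shift \<gamma>(1))
  qed
  show ?thesis
  proof (rule that)
    show "\<Xi>maps closure_of A \<subseteq> E\<Xi>"
      unfolding ellis_def A_def topspace_internal by (intro closure_of_mono) blast
    show "compactin \<Xi>maps (\<Xi>maps closure_of A)"
      by (rule closed_compactin[OF cB closure_of_minimal[OF \<open>A \<subseteq> B\<close> clB] closedin_closure_of])
    have "A \<subseteq> topspace \<Xi>maps" using \<open>A \<subseteq> B\<close> closedin_subset[OF clB] by blast
    then show "act \<gamma> \<in> \<Xi>maps closure_of A" if "\<gamma> \<in> \<Gamma>" "st \<gamma> \<in> K" for \<gamma>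
      using closure_of_subset[of A \<Xi>maps] that by (auto simp: A_def)
  qed
qed

lemma ellis_hull_compact_cover:
  obtains D where "D \<subseteq> E\<Xi> \<times> UNIV"
    "compactin (prod_topology (ellis_topology \<Xi>top shift \<Gamma>) euclidean) D" "E\<X> \<subseteq> susp_map ` D"
proof -
  obtain K \<rho> where K: "compact K" "\<And>h y. \<exists>\<gamma>\<in>\<Gamma>. h - st \<gamma> \<in> K \<and> norm (y - \<gamma>) \<le> \<rho>"
    using fundamental_domain by metis
  obtain E where E: "E \<subseteq> E\<Xi>" "compactin \<Xi>maps E" "\<And>\<gamma>. \<gamma> \<in> \<Gamma> \<Longrightarrow> st \<gamma> \<in> K \<Longrightarrow> act \<gamma> \<in> E"
    using ellis_bounded_compact[OF K(1)] by metis
  define D where "D = E \<times> cball (0::'e) \<rho>"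
  have "compactin (ellis_topology \<Xi>top shift \<Gamma>) E"
    using E(1,2) by (simp add: ellis_topology_def compactin_subtopology)
  then have D: "compactin (prod_topology (ellis_topology \<Xi>top shift \<Gamma>) euclidean) D"
    unfolding D_def compactin_Times by simp
  have "compactin \<X>maps (susp_map ` D)" by (rule image_compactin[OF D continuous_susp_map])
  then have "closedin \<X>maps (susp_map ` D)"
    using Hausdorff_hull by (intro compactin_imp_closedin) (auto simp: Hausdorff_space_product_topology)
  moreover have "act_map \<X>top unshift ` UNIV \<subseteq> susp_map ` D"
  proof (rule image_subsetI)
    fix t :: 'e
    \<comment> \<open>Cocompactness at the point (0, t). The star of \<open>- \<gamma>\<close> is
      the element found in \<open>K\<close>, and by the sign rule of \<open>susp_map_act\<close> the
      pair (\<open>act (- \<gamma>)\<close>, \<open>t - \<gamma>\<close>) acts as the translation by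
      \<open>t\<close>.\<close>
    obtain \<gamma> where \<gamma>: "\<gamma> \<in> \<Gamma>" "0 - st \<gamma> \<in> K" "norm (t - \<gamma>) \<le> \<rho>" using K(2) by blast
    have "susp_map (act (- \<gamma>), t - \<gamma>) = act_map \<X>top unshift t"
      using susp_map_act[OF minus_in[OF \<gamma>(1)], of "t - \<gamma>"] by simp
    moreover have "(act (- \<gamma>), t - \<gamma>) \<in> D"
      using \<gamma> E(3)[of "- \<gamma>"] by (simp add: D_def minus_in star_minus dist_norm norm_minus_commute)
    ultimately show "act_map \<X>top unshift t \<in> susp_map ` D" by (metis imageI)
  qed
  ultimately have "E\<X> \<subseteq> susp_map ` D" unfolding ellis_def topspace_hull by (rule closure_of_minimal[rotated])
  with D show ?thesis using E(1) by (intro that[of D]) (auto simp: D_def)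
qed

text \<open>A choice of representative gives the right value on every nonempty set on which
  \<open>susp_map\<close> is constant, so elementwise products of classes can be evaluated
  directly.\<close>

definition susp_hom :: "(('e set \<Rightarrow> 'e set) \<times> 'e) set \<Rightarrow> 'e set \<Rightarrow> 'e set" where
  "susp_hom c = susp_map (SOME p. p \<in> c)"

lemma susp_hom_eqI:
  assumes "c \<noteq> {}" "\<And>p. p \<in> c \<Longrightarrow> susp_map p = f"
  shows "susp_hom c = f"
  unfolding susp_hom_def using assms by (intro assms(2) some_in_eq[THEN iffD2])

section \<open>Classes of the suspension and descent of the map\<close>

lemma susp_product_mult:
  "(g, t) \<otimes>\<^bsub>susp_product \<Sigma> W\<^esub> (h, s) = (compose \<Xi> h g, t + s)"
  by (simp add: susp_product_def ellis_semigroup_def translation_group_def)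

lemma carrier_susp_product: "carrier (susp_product \<Sigma> W) = E\<Xi> \<times> UNIV"
  by (simp add: susp_product_def ellis_semigroup_def translation_group_def \<Gamma>_def)

lemma susp_class_eq:
  "susp_class \<Sigma> W (g, t) = {(compose \<Xi> (act \<gamma>) g, t + \<gamma>) | \<gamma>. \<gamma> \<in> \<Gamma>}"
  unfolding susp_class_def l_coset_def susp_diagonal_def \<Gamma>_def[symmetric]
  by (auto simp: susp_product_mult)

lemma susp_class_memberE:
  assumes "equivariant g" "p \<in> susp_class \<Sigma> W (g, t)"
  obtains g' t' where "p = (g', t')" "equivariant g'" "susp_map p = susp_map (g, t)"
proof -
  obtain \<gamma> where \<gamma>: "\<gamma> \<in> \<Gamma>" "p = (compose \<Xi> (act \<gamma>) g, t + \<gamma>)"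
    using assms(2) unfolding susp_class_eq by blast
  show ?thesis
    by (rule that[OF \<gamma>(2) equivariant_compose[OF assms(1) equivariant_act[OF \<gamma>(1)]]])
      (simp only: \<gamma>(2) susp_map_diagonal[OF assms(1) \<gamma>(1)])
qed

lemma susp_class_nonempty: "susp_class \<Sigma> W (g, t) \<noteq> {}"
  unfolding susp_class_eq using zero_in by blast

lemma susp_hom_class: "equivariant g \<Longrightarrow> susp_hom (susp_class \<Sigma> W (g, t)) = susp_map (g, t)"
  by (rule susp_hom_eqI[OF susp_class_nonempty]) (metis susp_class_memberE)

lemma susp_hom_mult:
  assumes g: "equivariant g" and h: "equivariant h"
  shows "susp_hom (susp_class \<Sigma> W (g, t) <#>\<^bsub>susp_product \<Sigma> W\<^esub> susp_class \<Sigma> W (h, s)) =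
    compose \<X> (susp_map (h, s)) (susp_map (g, t))"
proof (rule susp_hom_eqI)
  show "susp_class \<Sigma> W (g, t) <#>\<^bsub>susp_product \<Sigma> W\<^esub> susp_class \<Sigma> W (h, s) \<noteq> {}"
    using susp_class_nonempty[of g t] susp_class_nonempty[of h s] unfolding set_mult_def by auto
  fix p assume "p \<in> susp_class \<Sigma> W (g, t) <#>\<^bsub>susp_product \<Sigma> W\<^esub> susp_class \<Sigma> W (h, s)"
  then obtain a b where ab: "a \<in> susp_class \<Sigma> W (g, t)" "b \<in> susp_class \<Sigma> W (h, s)"
      "p = a \<otimes>\<^bsub>susp_product \<Sigma> W\<^esub> b"
    unfolding set_mult_def by blast
  obtain g' t' where g': "a = (g', t')" "equivariant g'" "susp_map a = susp_map (g, t)"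
    using susp_class_memberE[OF g ab(1)] .
  obtain h' s' where h': "b = (h', s')" "equivariant h'" "susp_map b = susp_map (h, s)"
    using susp_class_memberE[OF h ab(2)] .
  have "p = (compose \<Xi> h' g', t' + s')" unfolding ab(3) g'(1) h'(1) susp_product_mult ..
  then show "susp_map p = compose \<X> (susp_map (h, s)) (susp_map (g, t))"
    using g'(3) h'(3) unfolding g'(1) h'(1) by (simp only: susp_map_compose[OF g'(2) h'(2)])
qed

text \<open>Acting by \<gamma> and then by \<delta> is acting by their sum. The reverse inclusion
  comes in \<open>susp_class_eqI\<close> from exchanging the roles of the two pairs.\<close>

lemma susp_class_subset:
  assumes "equivariant g" "\<gamma> \<in> \<Gamma>"
  shows "susp_class \<Sigma> W (compose \<Xi> (act \<gamma>) g, t + \<gamma>) \<subseteq> susp_class \<Sigma> W (g, t)"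
proof
  fix p assume "p \<in> susp_class \<Sigma> W (compose \<Xi> (act \<gamma>) g, t + \<gamma>)"
  then obtain \<delta> where \<delta>: "\<delta> \<in> \<Gamma>"
      "p = (compose \<Xi> (act \<delta>) (compose \<Xi> (act \<gamma>) g), t + \<gamma> + \<delta>)"
    unfolding susp_class_eq by blast
  have "compose \<Xi> (act \<delta>) (compose \<Xi> (act \<gamma>) g) = compose \<Xi> (act (\<gamma> + \<delta>)) g"
    using equivariant_in[OF assms(1)] assms(2)
    by (intro extensionalityI[where A = \<Xi>])
      (simp_all add: compose_eq act_apply internal_shift shift_shift)
  then have "p = (compose \<Xi> (act (\<gamma> + \<delta>)) g, t + (\<gamma> + \<delta>))" using \<delta>(2) by (simp add: add.assoc)
  then show "p \<in> susp_class \<Sigma> W (g, t)" unfolding susp_class_eq using add_in[OF assms(2) \<delta>(1)] by blast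
qed

lemma susp_class_eqI:
  assumes g: "equivariant g" and h: "equivariant h" and eq: "susp_map (g, t) = susp_map (h, s)"
  shows "susp_class \<Sigma> W (g, t) = susp_class \<Sigma> W (h, s)"
proof -
  have "susp_class \<Sigma> W (h', s') \<subseteq> susp_class \<Sigma> W (g', t')"
    if "equivariant g'" "equivariant h'" "susp_map (g', t') = susp_map (h', s')" for g' h' t' s'
    using susp_map_eq_imp[OF that] susp_class_subset[OF that(1)] by metis
  from this[OF g h eq] this[OF h g eq[symmetric]] show ?thesis by (rule equalityI[rotated])
qed

lemma suspension_iso:
  "homeomorphic_map (suspension_topology \<Sigma> W) (hull_ellis_topology \<Sigma> W) susp_hom"
  "susp_hom \<in> iso (suspension \<Sigma> W) (hull_ellis \<Sigma> W)"
proof -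
  let ?Q = "prod_topology (ellis_topology \<Xi>top shift \<Gamma>) euclidean"
  let ?q = "susp_class \<Sigma> W"
  have topQ: "topspace ?Q = E\<Xi> \<times> UNIV" by (simp add: topspace_ellis)
  have hom_class: "susp_hom (?q p) = susp_map p" if "p \<in> E\<Xi> \<times> UNIV" for p
    using that susp_hom_class ellis_equivariant by (cases p) simp
  have quot: "quotient_map ?Q (suspension_topology \<Sigma> W) ?q"
    unfolding suspension_topology_def \<Gamma>_def by (rule quotient_map_quotient_topology)
  have tops: "topspace (suspension_topology \<Sigma> W) = ?q ` (E\<Xi> \<times> UNIV)"
    unfolding suspension_topology_def topspace_quotient_topology \<Gamma>_def[symmetric] topQ ..
  have carS: "carrier (suspension \<Sigma> W) = ?q ` (E\<Xi> \<times> UNIV)"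
    by (simp add: suspension_def carrier_susp_product)
  have carH: "carrier (hull_ellis \<Sigma> W) = E\<X>" by (simp add: ellis_semigroup_def)
  obtain D where D: "D \<subseteq> E\<Xi> \<times> UNIV" "compactin ?Q D" "E\<X> \<subseteq> susp_map ` D"
    using ellis_hull_compact_cover .
  have map_in: "susp_map p \<in> E\<X>" if "p \<in> E\<Xi> \<times> UNIV" for p
    using that susp_map_in_ellis by (cases p) simp
  have onto: "susp_hom ` ?q ` (E\<Xi> \<times> UNIV) = E\<X>"
  proof
    show "susp_hom ` ?q ` (E\<Xi> \<times> UNIV) \<subseteq> E\<X>" using hom_class map_in by auto
    show "E\<X> \<subseteq> susp_hom ` ?q ` (E\<Xi> \<times> UNIV)"
    proof
      fix f assume "f \<in> E\<X>"
      then obtain p where p: "p \<in> D" "f = susp_map p" using D(3) by blast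
      then have "p \<in> E\<Xi> \<times> UNIV" using D(1) by blast
      then show "f \<in> susp_hom ` ?q ` (E\<Xi> \<times> UNIV)" using hom_class p(2) by (metis imageI)
    qed
  qed
  have class_eq: "?q p = ?q p'" if "p \<in> E\<Xi> \<times> UNIV" "p' \<in> E\<Xi> \<times> UNIV" "susp_map p = susp_map p'" for p p'
  proof -
    have "equivariant (fst p)" "equivariant (fst p')" using that(1,2) ellis_equivariant by auto
    from susp_class_eqI[OF this, of "snd p" "snd p'"] that(3) show ?thesis by simp
  qed
  have inj: "inj_on susp_hom (?q ` (E\<Xi> \<times> UNIV))"
  proof (rule inj_onI)
    fix c c' assume "c \<in> ?q ` (E\<Xi> \<times> UNIV)" "c' \<in> ?q ` (E\<Xi> \<times> UNIV)" and eq: "susp_hom c = susp_hom c'"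
    then obtain p p' where p: "p \<in> E\<Xi> \<times> UNIV" "c = ?q p" "p' \<in> E\<Xi> \<times> UNIV" "c' = ?q p'" by (elim imageE)
    then show "c = c'" using class_eq[OF p(1,3)] eq hom_class by simp
  qed
  \<comment> \<open>\<open>D\<close> meets every class: the image of a pair is also attained on
    \<open>D\<close>, and equal images mean equal classes.\<close>
  have "?q ` (E\<Xi> \<times> UNIV) \<subseteq> ?q ` D"
  proof (rule image_subsetI)
    fix p :: "('e set \<Rightarrow> 'e set) \<times> 'e" assume p: "p \<in> E\<Xi> \<times> UNIV"
    then obtain p' where p': "p' \<in> D" "susp_map p = susp_map p'" using D(3) map_in by blast
    then show "?q p \<in> ?q ` D" using class_eq[OF p _ p'(2)] D(1) by (metis imageI subsetD)
  qed
  then have "?q ` D = topspace (suspension_topology \<Sigma> W)" using D(1) unfolding tops by blast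
  then have comp: "compact_space (suspension_topology \<Sigma> W)"
    using image_compactin[OF D(2) quotient_imp_continuous_map[OF quot]] by (simp add: compact_space_def)
  have top_ellis: "topspace (hull_ellis_topology \<Sigma> W) = E\<X>"
    using closure_of_subset_topspace[of \<X>maps] by (auto simp: ellis_topology_def ellis_def)
  have haus: "Hausdorff_space (hull_ellis_topology \<Sigma> W)"
    unfolding ellis_topology_def topspace_hull
    using Hausdorff_hull by (intro Hausdorff_space_subtopology) (simp add: Hausdorff_space_product_topology)
  have "continuous_map ?Q (hull_ellis_topology \<Sigma> W) susp_map"
    unfolding ellis_topology_def[of \<X>top] topspace_hull continuous_map_in_subtopology topQ
    using continuous_susp_map map_in by blast
  then have "continuous_map ?Q (hull_ellis_topology \<Sigma> W) (susp_hom \<circ> ?q)"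
    by (rule continuous_map_eq) (simp only: topQ hom_class o_apply)
  then have "continuous_map (suspension_topology \<Sigma> W) (hull_ellis_topology \<Sigma> W) susp_hom"
    by (rule continuous_compose_quotient_map[OF quot])
  then show "homeomorphic_map (suspension_topology \<Sigma> W) (hull_ellis_topology \<Sigma> W) susp_hom"
    by (rule continuous_imp_homeomorphic_map[OF _ comp haus])
      (simp_all only: tops top_ellis onto inj)
  show "susp_hom \<in> iso (suspension \<Sigma> W) (hull_ellis \<Sigma> W)"
  proof (rule isoI)
    show "bij_betw susp_hom (carrier (suspension \<Sigma> W)) (carrier (hull_ellis \<Sigma> W))"
      unfolding carS carH by (rule bij_betw_imageI[OF inj onto])
    show "susp_hom \<in> hom (suspension \<Sigma> W) (hull_ellis \<Sigma> W)"
    proof (rule homI)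
      fix c assume "c \<in> carrier (suspension \<Sigma> W)"
      then show "susp_hom c \<in> carrier (hull_ellis \<Sigma> W)" unfolding carS carH using onto by blast
    next
      fix c c' assume "c \<in> carrier (suspension \<Sigma> W)" "c' \<in> carrier (suspension \<Sigma> W)"
      then obtain g t h s where g: "g \<in> E\<Xi>" "c = ?q (g, t)" and h: "h \<in> E\<Xi>" "c' = ?q (h, s)"
        unfolding carS by auto
      show "susp_hom (c \<otimes>\<^bsub>suspension \<Sigma> W\<^esub> c') = susp_hom c \<otimes>\<^bsub>hull_ellis \<Sigma> W\<^esub> susp_hom c'"
        using susp_hom_mult[OF ellis_equivariant[OF g(1)] ellis_equivariant[OF h(1)]]
          susp_hom_class[OF ellis_equivariant[OF g(1)]] susp_hom_class[OF ellis_equivariant[OF h(1)]]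
        by (simp add: suspension_def ellis_semigroup_def g(2) h(2))
    qed
  qed
qed

end

theorem theorem3p6:
  fixes \<Sigma> :: "('h::{topological_ab_group_add, t2_space} \<times> 'e::euclidean_space) set"
    and W :: "'h set"
  assumes "cut_and_project_scheme \<Sigma>" and "window W"
  shows "\<exists>\<Phi>. homeomorphic_map (suspension_topology \<Sigma> W) (hull_ellis_topology \<Sigma> W) \<Phi> \<and>
             \<Phi> \<in> iso (suspension \<Sigma> W) (hull_ellis \<Sigma> W) \<and>
             (\<forall>g \<in> carrier (internal_ellis \<Sigma> W). \<forall>t.
                \<Phi> (susp_class \<Sigma> W (g, t)) = (\<lambda>\<Lambda>\<^sub>0\<in>model_hull \<Sigma> W. unshift t (tilde \<Sigma> W g \<Lambda>\<^sub>0)))"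
proof -
  interpret cut_and_project \<Sigma> W by standard (fact assms)+
  have "susp_hom (susp_class \<Sigma> W (g, t)) = (\<lambda>\<Lambda>\<^sub>0\<in>model_hull \<Sigma> W. unshift t (tilde \<Sigma> W g \<Lambda>\<^sub>0))"
    if "g \<in> carrier (internal_ellis \<Sigma> W)" for g t
  proof -
    have "g \<in> E\<Xi>" using that by (simp add: ellis_semigroup_def \<Gamma>_def)
    from susp_hom_class[OF ellis_equivariant[OF this], of t] show ?thesis by (simp add: susp_map_def)
  qed
  then show ?thesis using suspension_iso by blast
qed

end
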